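(* Let $a\geq 2$, $b\geq (a-1)^2+1$ and $r\geq 2$ be integers, and set $$\varepsilon:=\frac{r(a-1)-1}{\max\{R(K_{a,b},r),\,2r(a-1)+1\}}.$$ Then $\varepsilon<1/2$ and $$r(a-1)-\varepsilon \;\leq\; m^*(K_{a,b},r) \;<\; r(a-1)+1 .$$
   Context: All graphs are finite and simple. For a graph $F$ and an integer $r\geq 2$, a graph $G$ is called $(F,r)$-Ramsey if every $r$-coloring of the edges of $G$ contains a monochromatic copy of $F$ (as a not necessarily induced subgraph). For a graph $G$ define $m(G):=\max_{H\subseteq G} e(H)/v(H)$, where the maximum is over all subgraphs $H$ of $G$ with at least one vertex, and $e(H)$, $v(H)$ are the numbers of edges and vertices of $H$. The Ramsey density is $m^*(F,r):=\inf\{m(G) : G \text{ is } (F,r)\text{-Ramsey}\}$. The Ramsey number $R(F,r)$ is the minimal integer $N$ such that the complete graph $K_N$ is $(F,r)$-Ramsey. $K_{a,b}$ denotes the complete bipartite graph with partition classes of sizes $a$ and $b$. *)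

theory Defs
  imports Complex_Main "HOL-Library.Ramsey"
begin

text \<open>A graph is a pair of a vertex set and a set of edges, an edge being a two-element
  set of vertices.\<close>

type_synonym 'a ugraph = "'a set \<times> 'a set set"

abbreviation verts :: "'a ugraph \<Rightarrow> 'a set" where
  "verts G \<equiv> fst G"

abbreviation edges :: "'a ugraph \<Rightarrow> 'a set set" where
  "edges G \<equiv> snd G"

definition simple_graph :: "'a ugraph \<Rightarrow> bool" where
  "simple_graph G \<longleftrightarrow> finite (verts G) \<and> edges G \<subseteq> nsets (verts G) 2"

definition subgraph :: "'a ugraph \<Rightarrow> 'a ugraph \<Rightarrow> bool" where
  "subgraph H G \<longleftrightarrow> simple_graph H \<and> verts H \<subseteq> verts G \<and> edges H \<subseteq> edges G"

definition graph_iso :: "'a ugraph \<Rightarrow> 'b ugraph \<Rightarrow> bool" where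
  "graph_iso F H \<longleftrightarrow>
     (\<exists>f. bij_betw f (verts F) (verts H) \<and> edges H = (\<lambda>e. f ` e) ` edges F)"

definition complete_graph :: "nat \<Rightarrow> nat ugraph" where
  "complete_graph n = ({..<n}, nsets {..<n} 2)"

definition complete_bipartite :: "nat \<Rightarrow> nat \<Rightarrow> (nat + nat) ugraph" where
  "complete_bipartite a b = ({..<a} <+> {..<b}, {{Inl i, Inr j} | i j. i < a \<and> j < b})"

definition is_ramsey :: "'b ugraph \<Rightarrow> nat \<Rightarrow> 'a ugraph \<Rightarrow> bool" where
  "is_ramsey F r G \<longleftrightarrow>
     (\<forall>c. (\<forall>e\<in>edges G. c e < r) \<longrightarrow>
        (\<exists>H k. subgraph H G \<and> graph_iso F H \<and> k < r \<and> (\<forall>e\<in>edges H. c e = k)))"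

definition ramsey_number :: "'b ugraph \<Rightarrow> nat \<Rightarrow> nat" where
  "ramsey_number F r = (LEAST N. is_ramsey F r (complete_graph N))"

text \<open>The set below is finite; it is nonempty as soon as the graph has a vertex, which is
  the only case in which the value is meaningful.\<close>

definition max_density :: "'a ugraph \<Rightarrow> real" where
  "max_density G =
     Max {real (card (edges H)) / real (card (verts H)) | H. subgraph H G \<and> verts H \<noteq> {}}"

text \<open>Every finite graph is isomorphic to one whose vertices are natural numbers, so it
  suffices to let the infimum range over those.\<close>

definition ramsey_density :: "'b ugraph \<Rightarrow> nat \<Rightarrow> real" where
  "ramsey_density F r =
     Inf {max_density G | G :: nat ugraph. simple_graph G \<and> is_ramsey F r G}"

end

theory Submission
  imports Defs
begin

text \<open>Write \<open>d = r(a - 1)\<close>.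

For the upper bound, take a complete bipartite graph with \<open>d + 1\<close> vertices on one side and very
many on the other. Each vertex of the large side sends \<open>a\<close> edges of one colour to the small side,
and by the pigeonhole principle \<open>b\<close> of them agree in the colour and in the \<open>a\<close> endpoints. Every
subgraph has fewer than \<open>d + 1\<close> edges per vertex: the vertices of the large side, of degree at most
\<open>d + 1\<close>, account for all edges, and if there is an edge, then the small side adds another vertex.

The idea for the lower bound is arboricity. A union of \<open>a - 1\<close> forests on \<open>a + b\<close> vertices has at
most \<open>(a - 1)(a + b - 1)\<close> edges, which is less than \<open>ab\<close> precisely because \<open>b > (a - 1)\<^sup>2\<close>. So a
graph that decomposes into \<open>d\<close> forests is not Ramsey: give \<open>a - 1\<close> forests to each colour. By
Nash-Williams it decomposes unless some vertex set \<open>W\<close> spans more than \<open>d(|W| - 1)\<close> edges. Call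
such a set dense. A graph whose density is less than \<open>d - \<epsilon>\<close> may still have dense sets, but only
with fewer than \<open>max {R, 2d + 1}\<close> vertices; and a dense set has at least \<open>2d + 1\<close> vertices, by
comparison with the complete graph. So it has fewer than \<open>R\<close> vertices, and its edges have an
\<open>r\<close>-colouring without a monochromatic \<open>K\<^sub>a\<^sub>,\<^sub>b\<close>.

These two kinds of colouring are glued together. Partition the vertices into as few parts as
possible such that each part is dense or a single vertex (\<open>exists_condensing_labelling\<close>). By
minimality no union of at least two parts is dense. Contract every part. Since parts have many
edges inside and unions of parts have few, the remaining cross edges satisfy the Nash-Williams
condition in the contracted multigraph (\<open>card_cross_edges_le_rank\<close>) and decompose into \<open>d\<close>
forests. This decomposition is an instance of the matroid partition theorem
(\<open>matroid_partition\<close>), applied to \<open>d\<close> copies of the graphic matroid. Colour each part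
separately, and the cross edges by the forests. A copy of \<open>K\<^sub>a\<^sub>,\<^sub>b\<close> that meets \<open>k \<ge> 2\<close> parts has more
than \<open>(a - 1)(k - 1)\<close> cross edges (\<open>biclique_cross_pairs\<close>), too many for the \<open>a - 1\<close> forests of
one colour; a copy inside one part is excluded by the choice of the colouring there
(\<open>not_ramsey_if_dense_sets_not_ramsey\<close>).\<close>

section \<open>Partition into independent sets\<close>

text \<open>These are the rank functions of matroids, given by local conditions on adding one element: the
last one says that an element in the closure of a set is in the closure of every larger set. In
this form the conditions pass to contractions at once.\<close>

definition rank_function :: "('e set \<Rightarrow> nat) \<Rightarrow> bool" where
  "rank_function f \<longleftrightarrow> f {} = 0 \<and> mono f \<and>
     (\<forall>F x. f (insert x F) \<le> Suc (f F)) \<and>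
     (\<forall>F F' x. F \<subseteq> F' \<longrightarrow> f (insert x F) = f F \<longrightarrow> f (insert x F') = f F')"

lemma rank_functionD:
  assumes "rank_function f"
  shows "f {} = 0" "F \<subseteq> F' \<Longrightarrow> f F \<le> f F'" "f (insert x F) \<le> Suc (f F)"
    "F \<subseteq> F' \<Longrightarrow> f (insert x F) = f F \<Longrightarrow> f (insert x F') = f F'"
  using assms unfolding rank_function_def mono_def by blast+

lemma rank_union_le:
  assumes "rank_function f" "finite T"
  shows "f (S \<union> T) \<le> f S + card T"
  using assms(2)
proof induction
  case (insert x T)
  then show ?case
    using rank_functionD(3)[OF assms(1), of x "S \<union> T"] by simp
qed simp

text \<open>Add the elements of \<open>T\<close> one at a time, to \<open>S \<inter> T\<close> and in parallel to \<open>S\<close>. A step that leaves the rank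
of the smaller set unchanged also leaves that of the larger set unchanged.\<close>

lemma rank_submodular:
  assumes "rank_function f" "finite T"
  shows "f (S \<union> T) + f (S \<inter> T) \<le> f S + f T"
proof -
  have "f (S \<union> U) + f I \<le> f S + f (I \<union> U)" if "finite U" "I \<subseteq> S" for U I
    using that
  proof induction
    case (insert x U)
    have "f (insert x (S \<union> U)) = f (S \<union> U)" if "f (insert x (I \<union> U)) = f (I \<union> U)"
      using rank_functionD(4)[OF assms(1) _ that, of "S \<union> U"] insert.prems by blast
    moreover have "f (I \<union> U) \<le> f (insert x (I \<union> U))"
      by (rule rank_functionD(2)[OF assms(1)]) blast
    moreover note rank_functionD(3)[OF assms(1), of x "S \<union> U"] insert.IH[OF insert.prems]
    ultimately have "f (insert x (S \<union> U)) + f I \<le> f S + f (insert x (I \<union> U))"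
      by linarith
    then show ?case by simp
  next
    case empty
    then show ?case by simp
  qed
  from this[of T "S \<inter> T"] assms(2) show ?thesis
    by (simp add: Un_absorb1)
qed

lemma independent_subset:
  assumes "rank_function f" "finite I" "f I = card I" "J \<subseteq> I"
  shows "f J = card J"
proof -
  have "f I \<le> f J + card (I - J)"
    using rank_union_le[OF assms(1), of "I - J" J] assms(2,4) by (simp add: Un_absorb1)
  moreover have "card I = card J + card (I - J)"
    using assms(2,4) by (metis card_Diff_subset card_mono finite_subset le_add_diff_inverse)
  moreover have "f J \<le> card J"
    using rank_union_le[OF assms(1), of J "{}"] rank_functionD(1)[OF assms(1)]
      finite_subset[OF assms(4,2)] by simp
  ultimately show ?thesis using assms(3) by linarith
qed

lemma rank_function_contract:
  assumes "rank_function f" "f {x} = 1"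
  shows "rank_function (\<lambda>F. f (insert x F) - 1)"
proof -
  note R = rank_functionD[OF assms(1)]
  have pos: "f (insert x F) \<ge> 1" for F
    using R(2)[of "{x}" "insert x F"] assms(2) by simp
  show ?thesis
    unfolding rank_function_def mono_def
  proof (intro conjI allI impI)
    fix F F' y
    show "f {x} - 1 = 0" using assms(2) by simp
    show "f (insert x F) - 1 \<le> f (insert x F') - 1" if "F \<subseteq> F'"
      using R(2)[of "insert x F" "insert x F'"] that by (intro diff_le_mono) blast
    show "f (insert x (insert y F)) - 1 \<le> Suc (f (insert x F) - 1)"
      using R(3)[of y "insert x F"] by (simp add: insert_commute)
    show "f (insert x (insert y F')) - 1 = f (insert x F') - 1"
      if "F \<subseteq> F'" "f (insert x (insert y F)) - 1 = f (insert x F) - 1"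
    proof -
      have "f (insert y (insert x F)) = f (insert x F)"
        using that(2) pos[of F] pos[of "insert y F"] by (simp add: insert_commute)
      then have "f (insert y (insert x F')) = f (insert x F')"
        using R(4)[of "insert x F" "insert x F'" y] that(1) by blast
      then show ?thesis by (simp add: insert_commute)
    qed
  qed
qed

text \<open>Sets that attain equality in the rank condition are closed under union, because the sum of the
ranks is submodular while cardinality is modular.\<close>

lemma tight_UN:
  fixes f :: "nat \<Rightarrow> 'e set \<Rightarrow> nat" and n :: nat
  assumes "\<And>i. i < d \<Longrightarrow> rank_function (f i)" "finite E"
    and "\<And>F. F \<subseteq> E \<Longrightarrow> card F \<le> (\<Sum>i<d. f i F)"
    and "\<And>i. i < n \<Longrightarrow> T i \<subseteq> E" "\<And>i. i < n \<Longrightarrow> (\<Sum>j<d. f j (T i)) = card (T i)"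
  shows "(\<Sum>j<d. f j (\<Union>i<n. T i)) = card (\<Union>i<n. T i)"
  using assms(4,5)
proof (induction n)
  case 0
  then show ?case using rank_functionD(1)[OF assms(1)] by simp
next
  case (Suc n)
  let ?S = "\<Union>i<n. T i"
  have sub: "?S \<subseteq> E" "T n \<subseteq> E" using Suc.prems(1) by (fastforce simp: less_Suc_eq)+
  have fin: "finite ?S" "finite (T n)" using sub assms(2) finite_subset by blast+
  have S: "(\<Sum>j<d. f j ?S) = card ?S" and Tn: "(\<Sum>j<d. f j (T n)) = card (T n)"
    using Suc by simp_all
  have "(\<Sum>j<d. f j (?S \<union> T n)) + (\<Sum>j<d. f j (?S \<inter> T n)) \<le> (\<Sum>j<d. f j ?S) + (\<Sum>j<d. f j (T n))"
    unfolding sum.distrib[symmetric]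
    using rank_submodular[OF assms(1) fin(2), of _ ?S] by (intro sum_mono) simp
  moreover have "card (?S \<inter> T n) \<le> (\<Sum>j<d. f j (?S \<inter> T n))"
    using sub by (intro assms(3)) blast
  moreover have "card (?S \<union> T n) \<le> (\<Sum>j<d. f j (?S \<union> T n))"
    using sub by (intro assms(3)) blast
  moreover have "card ?S + card (T n) = card (?S \<union> T n) + card (?S \<inter> T n)"
    by (rule card_Un_Int[OF fin])
  ultimately have "(\<Sum>j<d. f j (?S \<union> T n)) = card (?S \<union> T n)"
    using S Tn by linarith
  moreover have "(\<Union>i<Suc n. T i) = ?S \<union> T n" by (auto simp: less_Suc_eq)
  ultimately show ?case by simp
qed

text \<open>The matroid partition theorem of Edmonds. The induction removes an element \<open>x\<close> of the ground set
and contracts it in one of the matroids, which puts \<open>x\<close> into the class of that matroid. If this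
violates the rank condition for every matroid \<open>i\<close>, then each \<open>i\<close> has a tight set whose closure in
the matroid \<open>i\<close> contains \<open>x\<close>. The union of these sets is tight, and its closure contains \<open>x\<close> in every
matroid; adding \<open>x\<close> to it violates the rank condition. Letting the matroids differ is
what makes the induction work, even for copies of a single matroid.\<close>

lemma matroid_partition:
  fixes f :: "nat \<Rightarrow> 'e set \<Rightarrow> nat"
  assumes "finite E" "\<And>i. i < d \<Longrightarrow> rank_function (f i)"
    and "\<And>F. F \<subseteq> E \<Longrightarrow> card F \<le> (\<Sum>i<d. f i F)"
  shows "\<exists>c. (\<forall>e\<in>E. c e < d) \<and> (\<forall>i<d. f i {e\<in>E. c e = i} = card {e\<in>E. c e = i})"
  using assms
proof (induction E arbitrary: f rule: finite_induct)
  case empty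
  then show ?case using rank_functionD(1) by fastforce
next
  case (insert x E)
  note R = rank_functionD[OF insert.prems(1)]
  \<comment> \<open>the family in which \<open>x\<close> has been contracted in the matroid \<open>i\<close>\<close>
  define g where "g i = f(i := (\<lambda>F. f i (insert x F) - 1))" for i
  have sum_g: "(\<Sum>j<d. g i j F) + f i F = (\<Sum>j<d. f j F) + (f i (insert x F) - 1)"
    if "i < d" for i F
    using that by (simp add: g_def sum.remove[of "{..<d}" i])
  show ?case
  proof (cases "\<exists>i<d. f i {x} = 1 \<and> (\<forall>F\<subseteq>E. card F \<le> (\<Sum>j<d. g i j F))")
    case True
    then obtain i where i: "i < d" "f i {x} = 1" "\<And>F. F \<subseteq> E \<Longrightarrow> card F \<le> (\<Sum>j<d. g i j F)"
      by blast
    have "rank_function (g i j)" if "j < d" for j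
      using rank_function_contract[OF insert.prems(1)[OF i(1)] i(2)] insert.prems(1)[OF that]
      by (simp add: g_def)
    from insert.IH[OF this i(3)] obtain c
      where c: "\<forall>e\<in>E. c e < d" "\<forall>j<d. g i j {e\<in>E. c e = j} = card {e\<in>E. c e = j}"
      by blast
    define c' where "c' = c(x := i)"
    have "f j {e\<in>insert x E. c' e = j} = card {e\<in>insert x E. c' e = j}" if j: "j < d" for j
    proof (cases "j = i")
      case True
      have eq: "{e\<in>insert x E. c' e = i} = insert x {e\<in>E. c e = i}"
        using insert.hyps by (auto simp: c'_def)
      have "f i (insert x {e\<in>E. c e = i}) \<ge> 1"
        using R(2)[OF i(1), of "{x}" "insert x {e\<in>E. c e = i}"] i(2) by simp
      moreover have "f i (insert x {e\<in>E. c e = i}) - 1 = card {e\<in>E. c e = i}"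
        using c(2)[rule_format, OF i(1)] by (simp add: g_def)
      ultimately show ?thesis
        using insert.hyps unfolding True eq by simp
    next
      case False
      have "{e\<in>insert x E. c' e = j} = {e\<in>E. c e = j}"
        using insert.hyps False by (auto simp: c'_def)
      then show ?thesis using c(2)[rule_format, OF j] False by (simp add: g_def)
    qed
    moreover have "\<forall>e\<in>insert x E. c' e < d" using c(1) i(1) by (simp add: c'_def)
    ultimately show ?thesis by blast
  next
    case False
    have "\<exists>T. T \<subseteq> E \<and> (\<Sum>j<d. f j T) = card T \<and> f i (insert x T) = f i T" if i: "i < d" for i
    proof (cases "f i {x} = 1")
      case True
      then obtain F where F: "F \<subseteq> E" "card F > (\<Sum>j<d. g i j F)"
        using False i by (meson not_le)
      have "card F \<le> (\<Sum>j<d. f j F)" using F(1) by (intro insert.prems(2)) blast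
      moreover have "f i (insert x F) \<ge> 1"
        using R(2)[OF i, of "{x}" "insert x F"] True by simp
      moreover have "f i (insert x F) \<ge> f i F"
        using R(2)[OF i, of F "insert x F"] by blast
      ultimately have "(\<Sum>j<d. f j F) = card F" "f i (insert x F) = f i F"
        using sum_g[OF i, of F] F(2) by linarith+
      then show ?thesis using F(1) by blast
    next
      case False
      then have "f i {x} = 0" using R(1)[OF i] R(3)[OF i, of x "{}"] by simp
      \<comment> \<open>a loop cannot be contracted, but then the empty set is tight with \<open>x\<close> in its closure\<close>
      then show ?thesis using R(1) i by (intro exI[of _ "{}"]) simp
    qed
    then obtain T where T: "\<And>i. i < d \<Longrightarrow> T i \<subseteq> E"
      "\<And>i. i < d \<Longrightarrow> (\<Sum>j<d. f j (T i)) = card (T i)"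
      "\<And>i. i < d \<Longrightarrow> f i (insert x (T i)) = f i (T i)"
      by metis
    let ?U = "\<Union>i<d. T i"
    have sub: "?U \<subseteq> E" using T(1) by blast
    have "(\<Sum>j<d. f j ?U) = card ?U"
    proof (rule tight_UN[of d f E])
      show "card F \<le> (\<Sum>i<d. f i F)" if "F \<subseteq> E" for F
        using that by (intro insert.prems(2)) blast
    qed (use T insert.prems(1) insert.hyps in auto)
    moreover have "(\<Sum>j<d. f j (insert x ?U)) = (\<Sum>j<d. f j ?U)"
      using R(4)[OF _ _ T(3), of _ ?U] by (intro sum.cong) auto
    moreover have "card (insert x ?U) \<le> (\<Sum>j<d. f j (insert x ?U))"
      using sub by (intro insert.prems(2)) blast
    moreover have "card (insert x ?U) = Suc (card ?U)"
      using sub insert.hyps finite_subset[OF sub] by (intro card_insert_disjoint) auto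
    ultimately show ?thesis by simp
  qed
qed

section \<open>The graphic matroid after contracting the fibres of a labelling\<close>

lemma card_image_le_if_factors:
  assumes "finite V" "\<And>x y. x \<in> V \<Longrightarrow> y \<in> V \<Longrightarrow> f x = f y \<Longrightarrow> g x = g y"
  shows "card (g ` V) \<le> card (f ` V)"
proof -
  have "g ` V \<subseteq> (\<lambda>z. g (inv_into V f z)) ` (f ` V)"
  proof (rule image_subsetI)
    fix x assume x: "x \<in> V"
    have "g x = g (inv_into V f (f x))"
      by (rule assms(2)[OF x]) (rule inv_into_into[OF imageI[OF x]], rule f_inv_into_f[OF imageI[OF x], symmetric])
    also have "\<dots> \<in> (\<lambda>z. g (inv_into V f z)) ` (f ` V)" using x by (intro imageI)
    finally show "g x \<in> (\<lambda>z. g (inv_into V f z)) ` (f ` V)" .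
  qed
  then show ?thesis
    using assms(1) by (meson card_image_le card_mono finite_imageI le_trans)
qed

text \<open>Connectedness in the multigraph that arises from \<open>F\<close> by identifying vertices with equal
labels. Working with labels on the original vertices avoids multigraphs: edges that become
parallel stay distinct as sets.\<close>

definition linked :: "'a set \<Rightarrow> ('a \<Rightarrow> 'b) \<Rightarrow> 'a set set \<Rightarrow> ('a \<times> 'a) set" where
  "linked V \<pi> F = {(u, v). u \<in> V \<and> v \<in> V \<and> (\<pi> u = \<pi> v \<or> {u, v} \<in> F)}\<^sup>*"

definition component :: "'a set \<Rightarrow> ('a \<Rightarrow> 'b) \<Rightarrow> 'a set set \<Rightarrow> 'a \<Rightarrow> 'a set" where
  "component V \<pi> F x = linked V \<pi> F `` {x}"

text \<open>The number of vertices of the contracted multigraph minus the number of its components, which is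
the size of a spanning forest.\<close>

definition contracted_rank :: "'a set \<Rightarrow> ('a \<Rightarrow> 'b) \<Rightarrow> 'a set set \<Rightarrow> nat" where
  "contracted_rank V \<pi> F = card (\<pi> ` V) - card (component V \<pi> F ` V)"

lemma linked_refl: "(u, u) \<in> linked V \<pi> F"
  by (simp add: linked_def)

lemma linked_sym: "(u, v) \<in> linked V \<pi> F \<Longrightarrow> (v, u) \<in> linked V \<pi> F"
  unfolding linked_def
  by (rule symD[OF sym_rtrancl]) (auto simp: sym_def insert_commute)

lemma linked_trans: "(u, v) \<in> linked V \<pi> F \<Longrightarrow> (v, w) \<in> linked V \<pi> F \<Longrightarrow> (u, w) \<in> linked V \<pi> F"
  unfolding linked_def by (rule rtrancl_trans)

lemma trans_linked: "trans (linked V \<pi> F)"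
  by (simp add: linked_def trans_rtrancl)

lemma refl_linked: "refl (linked V \<pi> F)"
  by (simp add: refl_on_def linked_refl)

lemma linked_label: "u \<in> V \<Longrightarrow> v \<in> V \<Longrightarrow> \<pi> u = \<pi> v \<Longrightarrow> (u, v) \<in> linked V \<pi> F"
  unfolding linked_def by (rule r_into_rtrancl) simp

lemma linked_edge: "u \<in> V \<Longrightarrow> v \<in> V \<Longrightarrow> {u, v} \<in> F \<Longrightarrow> (u, v) \<in> linked V \<pi> F"
  unfolding linked_def by (rule r_into_rtrancl) simp

lemma linked_mono: "F \<subseteq> F' \<Longrightarrow> linked V \<pi> F \<subseteq> linked V \<pi> F'"
  unfolding linked_def by (rule rtrancl_mono) blast

lemma linked_induct:
  assumes "(x, y) \<in> linked V \<pi> F" "trans S" "refl S"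
    and "\<And>u v. u \<in> V \<Longrightarrow> v \<in> V \<Longrightarrow> \<pi> u = \<pi> v \<Longrightarrow> (u, v) \<in> S"
    and "\<And>u v. u \<in> V \<Longrightarrow> v \<in> V \<Longrightarrow> {u, v} \<in> F \<Longrightarrow> (u, v) \<in> S"
  shows "(x, y) \<in> S"
  using assms(1) unfolding linked_def
proof (induction rule: rtrancl_induct)
  case base
  then show ?case using assms(3) by (simp add: refl_on_def)
next
  case (step y z)
  then have "(y, z) \<in> S" using assms(4,5) by blast
  then show ?case using step.IH assms(2) by (meson transD)
qed

lemma component_eq_iff: "component V \<pi> F x = component V \<pi> F y \<longleftrightarrow> (x, y) \<in> linked V \<pi> F"
proof
  assume "component V \<pi> F x = component V \<pi> F y"
  then show "(x, y) \<in> linked V \<pi> F"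
    using linked_refl[of y V \<pi> F] unfolding component_def by blast
next
  assume L: "(x, y) \<in> linked V \<pi> F"
  show "component V \<pi> F x = component V \<pi> F y"
    unfolding component_def using linked_trans[OF L] linked_trans[OF linked_sym[OF L]] by blast
qed

lemma component_subset:
  assumes "x \<in> V"
  shows "component V \<pi> F x \<subseteq> V"
proof
  fix y assume "y \<in> component V \<pi> F x"
  then have "(x, y) \<in> linked V \<pi> F" by (simp add: component_def)
  then have "(x, y) \<in> {(u, v). u \<in> V \<longrightarrow> v \<in> V}"
    by (rule linked_induct) (auto simp: trans_def refl_on_def)
  then show "y \<in> V" using assms by simp
qed

text \<open>A labelling that is constant along all links is constant on components, so it certifies a lower
bound for the number of components.\<close>

lemma card_components_ge:
  assumes "finite V" "\<And>u v. u \<in> V \<Longrightarrow> v \<in> V \<Longrightarrow> \<pi> u = \<pi> v \<or> {u, v} \<in> F \<Longrightarrow> \<phi> u = \<phi> v"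
  shows "card (\<phi> ` V) \<le> card (component V \<pi> F ` V)"
proof (rule card_image_le_if_factors[OF assms(1)])
  fix x y assume "component V \<pi> F x = component V \<pi> F y"
  then have "(x, y) \<in> linked V \<pi> F" by (simp add: component_eq_iff)
  then have "(x, y) \<in> {(u, v). \<phi> u = \<phi> v}"
  proof (rule linked_induct)
    fix u v assume "u \<in> V" "v \<in> V" "\<pi> u = \<pi> v"
    then show "(u, v) \<in> {(u, v). \<phi> u = \<phi> v}" using assms(2)[of u v] by simp
  next
    fix u v assume "u \<in> V" "v \<in> V" "{u, v} \<in> F"
    then show "(u, v) \<in> {(u, v). \<phi> u = \<phi> v}" using assms(2)[of u v] by simp
  qed (auto simp: trans_def refl_on_def)
  then show "\<phi> x = \<phi> y" by simp
qed

lemma card_components_le: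
  assumes "finite V"
  shows "card (component V \<pi> F ` V) \<le> card (\<pi> ` V)"
  by (rule card_image_le_if_factors[OF assms]) (simp add: component_eq_iff linked_label)

lemma card_components_antimono:
  assumes "finite V" "F \<subseteq> F'"
  shows "card (component V \<pi> F' ` V) \<le> card (component V \<pi> F ` V)"
  using linked_mono[OF assms(2)]
  by (intro card_image_le_if_factors[OF assms(1)]) (auto simp: component_eq_iff)

lemma linked_insert_same:
  assumes "\<And>u v. u \<in> V \<Longrightarrow> v \<in> V \<Longrightarrow> e = {u, v} \<Longrightarrow> (u, v) \<in> linked V \<pi> F"
  shows "linked V \<pi> (insert e F) = linked V \<pi> F"
proof
  show "linked V \<pi> (insert e F) \<subseteq> linked V \<pi> F"
  proof (rule subrelI)
    fix x y assume "(x, y) \<in> linked V \<pi> (insert e F)"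
    then show "(x, y) \<in> linked V \<pi> F"
    proof (rule linked_induct[OF _ trans_linked refl_linked])
      fix u v assume uv: "u \<in> V" "v \<in> V" "{u, v} \<in> insert e F"
      show "(u, v) \<in> linked V \<pi> F"
        using assms[OF uv(1,2)] linked_edge[OF uv(1,2), of F \<pi>] uv(3) by blast
    qed (rule linked_label)
  qed
  show "linked V \<pi> F \<subseteq> linked V \<pi> (insert e F)"
    by (rule linked_mono) blast
qed

lemma component_insert_merge:
  assumes "u \<in> V" "v \<in> V"
  shows "component V \<pi> (insert {u, v} F) x =
    (if x \<in> component V \<pi> F u \<union> component V \<pi> F v
     then component V \<pi> F u \<union> component V \<pi> F v else component V \<pi> F x)"
proof -
  let ?L = "linked V \<pi> F" and ?L' = "linked V \<pi> (insert {u, v} F)"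
  let ?C = "component V \<pi> F u \<union> component V \<pi> F v"
  have C: "y \<in> ?C \<longleftrightarrow> (u, y) \<in> ?L \<or> (v, y) \<in> ?L" for y by (auto simp: component_def)
  have sub: "?L \<subseteq> ?L'" by (rule linked_mono) blast
  have uv: "(u, v) \<in> ?L'" using assms by (intro linked_edge) auto
  have C_linked: "(u, y) \<in> ?L'" if "y \<in> ?C" for y
    using that sub uv unfolding C by (meson linked_trans subsetD)
  have "(x, y) \<in> ?L' \<longleftrightarrow> (x, y) \<in> ?L \<or> (x \<in> ?C \<and> y \<in> ?C)" for x y
  proof
    assume "(x, y) \<in> ?L'"
    then have "(x, y) \<in> {(x, y). (x, y) \<in> ?L \<or> (x \<in> ?C \<and> y \<in> ?C)}"
    proof (rule linked_induct)
      show "trans {(x, y). (x, y) \<in> ?L \<or> (x \<in> ?C \<and> y \<in> ?C)}"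
        unfolding trans_def mem_Collect_eq case_prod_conv C
        by (meson linked_sym linked_trans)
      fix a b assume "a \<in> V" "b \<in> V" "{a, b} \<in> insert {u, v} F"
      then show "(a, b) \<in> {(x, y). (x, y) \<in> ?L \<or> (x \<in> ?C \<and> y \<in> ?C)}"
        unfolding mem_Collect_eq case_prod_conv C
        using linked_edge[of a V b F \<pi>] linked_refl[of _ V \<pi> F] by (auto simp: doubleton_eq_iff)
    qed (auto simp: refl_on_def linked_refl linked_label)
    then show "(x, y) \<in> ?L \<or> (x \<in> ?C \<and> y \<in> ?C)" by simp
  next
    assume "(x, y) \<in> ?L \<or> (x \<in> ?C \<and> y \<in> ?C)"
    then show "(x, y) \<in> ?L'" using sub C_linked by (meson linked_sym linked_trans subsetD)
  qed
  moreover have "y \<in> ?C" if "x \<in> ?C" "(x, y) \<in> ?L" for y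
    using that unfolding C by (meson linked_trans)
  ultimately show ?thesis
    by (auto simp: component_def)
qed

lemma card_components_insert:
  assumes "finite V" "u \<in> V" "v \<in> V" "(u, v) \<notin> linked V \<pi> F"
  shows "card (component V \<pi> F ` V) = Suc (card (component V \<pi> (insert {u, v} F) ` V))"
proof -
  let ?\<kappa> = "component V \<pi> F"
  let ?C = "?\<kappa> u \<union> ?\<kappa> v"
  let ?O = "?\<kappa> ` V - {?\<kappa> u, ?\<kappa> v}"
  have self: "x \<in> ?\<kappa> x" for x by (simp add: component_def linked_refl)
  have memD: "?\<kappa> x = ?\<kappa> y" if "x \<in> ?\<kappa> y" for x y
    unfolding component_eq_iff by (rule linked_sym) (use that in \<open>simp add: component_def\<close>)
  have ne: "?\<kappa> u \<noteq> ?\<kappa> v" using assms(4) by (simp add: component_eq_iff)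
  have "?C \<notin> ?\<kappa> ` V"
  proof
    assume "?C \<in> ?\<kappa> ` V"
    then obtain w where w: "?C = ?\<kappa> w" by blast
    have "?\<kappa> u = ?\<kappa> w" by (rule memD) (use w self[of u] in blast)
    moreover have "?\<kappa> v = ?\<kappa> w" by (rule memD) (use w self[of v] in blast)
    ultimately show False using ne by simp
  qed
  moreover have "component V \<pi> (insert {u, v} F) ` V = insert ?C ?O"
  proof
    show "component V \<pi> (insert {u, v} F) ` V \<subseteq> insert ?C ?O"
    proof (rule image_subsetI)
      fix x assume x: "x \<in> V"
      have "?\<kappa> x \<in> ?O" if "x \<notin> ?C"
        using self[of x] that x by blast
      then show "component V \<pi> (insert {u, v} F) x \<in> insert ?C ?O"
        unfolding component_insert_merge[OF assms(2,3), of \<pi> F x] by (cases "x \<in> ?C") simp_all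
    qed
    show "insert ?C ?O \<subseteq> component V \<pi> (insert {u, v} F) ` V"
    proof
      fix X assume "X \<in> insert ?C ?O"
      then consider "X = ?C" | w where "w \<in> V" "X = ?\<kappa> w" "?\<kappa> w \<noteq> ?\<kappa> u" "?\<kappa> w \<noteq> ?\<kappa> v"
        by blast
      then show "X \<in> component V \<pi> (insert {u, v} F) ` V"
      proof cases
        case 1
        have "component V \<pi> (insert {u, v} F) u = ?C"
          using self[of u] unfolding component_insert_merge[OF assms(2,3), of \<pi> F u] by (intro if_P) blast
        then have "X = component V \<pi> (insert {u, v} F) u" using 1 by simp
        then show ?thesis using assms(2) by blast
      next
        case 2
        have "w \<notin> ?C" using memD[of w u] memD[of w v] 2(3,4) by blast
        then have "component V \<pi> (insert {u, v} F) w = ?\<kappa> w"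
          unfolding component_insert_merge[OF assms(2,3), of \<pi> F w] by (rule if_not_P)
        then have "X = component V \<pi> (insert {u, v} F) w" using 2(2) by simp
        then show ?thesis using 2 by blast
      qed
    qed
  qed
  moreover have "card ?O + 2 = card (?\<kappa> ` V)"
  proof -
    have "card {?\<kappa> u, ?\<kappa> v} = 2" using ne by simp
    moreover have "{?\<kappa> u, ?\<kappa> v} \<subseteq> ?\<kappa> ` V" using assms(2,3) by blast
    ultimately show ?thesis
      using card_mono[of "?\<kappa> ` V" "{?\<kappa> u, ?\<kappa> v}"] card_Diff_subset[of "{?\<kappa> u, ?\<kappa> v}" "?\<kappa> ` V"] assms(1)
      by simp
  qed
  ultimately show ?thesis using assms(1) by simp
qed

text \<open>Adding an edge merges two components if its ends are not yet linked, and changes nothing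
otherwise. Hence an edge leaves the rank unchanged exactly if its ends are linked already, and they
stay linked when further edges are added.\<close>

lemma rank_function_contracted_rank:
  assumes "finite V"
  shows "rank_function (contracted_rank V \<pi>)"
  unfolding rank_function_def
proof (intro conjI allI impI monoI)
  let ?c = "\<lambda>F. card (component V \<pi> F ` V)"
  note le = card_components_le[OF assms, of \<pi>]
  have same: "?c (insert e F) = ?c F"
    if "\<And>u v. u \<in> V \<Longrightarrow> v \<in> V \<Longrightarrow> e = {u, v} \<Longrightarrow> (u, v) \<in> linked V \<pi> F" for e F
    using linked_insert_same[of V e \<pi> F] that unfolding component_def[abs_def] by simp
  show "contracted_rank V \<pi> {} = 0"
    using card_components_ge[OF assms, of \<pi> "{}" \<pi>] by (simp add: contracted_rank_def)
  show "contracted_rank V \<pi> F \<le> contracted_rank V \<pi> F'" if "F \<subseteq> F'" for F F'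
    using card_components_antimono[OF assms that, of \<pi>] by (simp add: contracted_rank_def)
  show "contracted_rank V \<pi> (insert e F) \<le> Suc (contracted_rank V \<pi> F)" for F e
  proof (cases "\<exists>u\<in>V. \<exists>v\<in>V. e = {u, v} \<and> (u, v) \<notin> linked V \<pi> F")
    case True
    then obtain u v where "u \<in> V" "v \<in> V" "e = {u, v}" "(u, v) \<notin> linked V \<pi> F" by blast
    then have "?c F = Suc (?c (insert e F))"
      using card_components_insert[OF assms] by metis
    then show ?thesis by (simp add: contracted_rank_def)
  next
    case False
    then have "?c (insert e F) = ?c F" by (intro same) blast
    then show ?thesis by (simp add: contracted_rank_def)
  qed
  show "contracted_rank V \<pi> (insert e F') = contracted_rank V \<pi> F'"
    if "F \<subseteq> F'" "contracted_rank V \<pi> (insert e F) = contracted_rank V \<pi> F" for F F' e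
  proof -
    have "?c (insert e F) = ?c F"
      using that(2) le[of F] le[of "insert e F"] by (simp add: contracted_rank_def)
    then have L: "(u, v) \<in> linked V \<pi> F" if "u \<in> V" "v \<in> V" "e = {u, v}" for u v
      using card_components_insert[OF assms that(1,2), of \<pi> F] that(3) by (metis n_not_Suc_n)
    have "?c (insert e F') = ?c F'"
      by (rule same) (rule subsetD[OF linked_mono[OF \<open>F \<subseteq> F'\<close>] L])
    then show ?thesis by (simp add: contracted_rank_def)
  qed
qed

section \<open>Decomposing the edges between the parts of a partition\<close>

definition induced_edges :: "'a set set \<Rightarrow> 'a set \<Rightarrow> 'a set set" where
  "induced_edges E W = {e \<in> E. e \<subseteq> W}"

definition cross_edges :: "('a \<Rightarrow> 'b) \<Rightarrow> 'a set set \<Rightarrow> 'a set set" where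
  "cross_edges \<pi> E = {e \<in> E. \<forall>q. \<not> e \<subseteq> \<pi> -` {q}}"

text \<open>Edges within \<open>T\<close> leave every label outside \<open>\<pi> ` T\<close> in a component of its own. This is the bound
\<open>k - 1\<close> for the number of edges of a forest on \<open>k\<close> vertices.\<close>

lemma contracted_rank_less:
  assumes "finite V" "T \<subseteq> V" "T \<noteq> {}" "\<And>e. e \<in> F \<Longrightarrow> e \<subseteq> T"
  shows "contracted_rank V \<pi> F < card (\<pi> ` T)"
proof -
  \<comment> \<open>the option type supplies one common value for all labels that occur in \<open>T\<close>\<close>
  define \<phi> where "\<phi> v = (if \<pi> v \<in> \<pi> ` T then None else Some (\<pi> v))" for v
  have "card (\<phi> ` V) \<le> card (component V \<pi> F ` V)"
  proof (rule card_components_ge[OF assms(1)])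
    fix u v assume "\<pi> u = \<pi> v \<or> {u, v} \<in> F"
    then consider "\<pi> u = \<pi> v" | "u \<in> T" "v \<in> T" using assms(4)[of "{u, v}"] by blast
    then show "\<phi> u = \<phi> v" by cases (auto simp: \<phi>_def)
  qed
  moreover have "card (\<phi> ` V) = Suc (card (\<pi> ` V - \<pi> ` T))"
  proof -
    have "\<phi> ` V = insert None (Some ` (\<pi> ` V - \<pi> ` T))"
    proof
      show "\<phi> ` V \<subseteq> insert None (Some ` (\<pi> ` V - \<pi> ` T))"
        by (auto simp: \<phi>_def)
      obtain t where "t \<in> T" "t \<in> V" using assms(2,3) by blast
      then have "None \<in> \<phi> ` V" by (intro image_eqI[of _ _ t]) (auto simp: \<phi>_def)
      moreover have "Some z \<in> \<phi> ` V" if "z \<in> \<pi> ` V - \<pi> ` T" for z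
      proof -
        obtain v where "v \<in> V" "z = \<pi> v" using \<open>z \<in> \<pi> ` V - \<pi> ` T\<close> by blast
        then have "\<phi> v = Some z" using \<open>z \<in> \<pi> ` V - \<pi> ` T\<close> by (simp add: \<phi>_def)
        then show ?thesis using \<open>v \<in> V\<close> by (metis imageI)
      qed
      ultimately show "insert None (Some ` (\<pi> ` V - \<pi> ` T)) \<subseteq> \<phi> ` V" by blast
    qed
    then show ?thesis
      using assms(1) by (simp add: card_image)
  qed
  moreover have "card (\<pi> ` V - \<pi> ` T) = card (\<pi> ` V) - card (\<pi> ` T)"
    using assms(1,2) by (intro card_Diff_subset finite_imageI image_mono finite_subset[OF assms(2)])
  moreover have "card (\<pi> ` T) \<le> card (\<pi> ` V)"
    using assms(1,2) by (intro card_mono image_mono finite_imageI)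
  moreover have "card (\<pi> ` T) > 0"
    using assms(1-3) by (simp add: card_gt_0_iff finite_subset)
  ultimately show ?thesis unfolding contracted_rank_def by linarith
qed

text \<open>The Nash-Williams condition for the fibres over \<open>Q\<close>. The edges in their union are the cross edges
together with the edges inside the fibres. Each of the \<open>card Q\<close> fibres contains at least
\<open>d(n - 1)\<close> edges, \<open>n\<close> being its size, and their union of size \<open>m\<close> at most \<open>d(m - 1)\<close>, which leaves
at most \<open>d(card Q - 1)\<close> for the cross edges. Here \<open>d\<close> is added on both sides to avoid subtraction.\<close>

lemma card_cross_edges_fibres:
  assumes "finite V" "E \<subseteq> nsets V 2" "Q \<subseteq> \<pi> ` V" "Q \<noteq> {}"
    and dense: "\<And>q. q \<in> Q \<Longrightarrow>
      d * card (V \<inter> \<pi> -` {q}) \<le> card (induced_edges E (V \<inter> \<pi> -` {q})) + d"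
    and sparse: "card Q \<ge> 2 \<Longrightarrow>
      card (induced_edges E (V \<inter> \<pi> -` Q)) + d \<le> d * card (V \<inter> \<pi> -` Q)"
  shows "card (induced_edges (cross_edges \<pi> E) (V \<inter> \<pi> -` Q)) + d \<le> d * card Q"
proof -
  let ?W = "V \<inter> \<pi> -` Q" and ?fib = "\<lambda>q. V \<inter> \<pi> -` {q}"
  let ?X = "induced_edges (cross_edges \<pi> E) ?W"
  have finQ: "finite Q" using assms(1,3) finite_subset by blast
  have finE: "finite E" using assms(1,2) finite_imp_finite_nsets finite_subset by blast
  have ne: "e \<noteq> {}" if "e \<in> E" for e using that assms(2) by (auto simp: nsets_def)
  show ?thesis
  proof (cases "card Q \<ge> 2")
    case False
    then have "card Q = 1"
      using finQ assms(4) by (metis One_nat_def Suc_leI card_gt_0_iff le_antisym not_less_eq_eq numeral_2_eq_2)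
    then obtain q where "Q = {q}" by (auto simp: card_1_singleton_iff)
    then have "?X = {}" by (auto simp: induced_edges_def cross_edges_def)
    then show ?thesis using \<open>card Q = 1\<close> by simp
  next
    case True
    have "card ?X + (\<Sum>q\<in>Q. card (induced_edges E (?fib q)))
        = card (?X \<union> (\<Union>q\<in>Q. induced_edges E (?fib q)))"
    proof -
      have "card (\<Union>q\<in>Q. induced_edges E (?fib q)) = (\<Sum>q\<in>Q. card (induced_edges E (?fib q)))"
        using finQ finE ne by (intro card_UN_disjoint) (fastforce simp: induced_edges_def)+
      moreover have "?X \<inter> (\<Union>q\<in>Q. induced_edges E (?fib q)) = {}"
        by (auto simp: induced_edges_def cross_edges_def)
      ultimately show ?thesis
        using finQ finE by (subst card_Un_disjoint) (auto simp: induced_edges_def cross_edges_def)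
    qed
    also have "\<dots> \<le> card (induced_edges E ?W)"
      using finE by (intro card_mono) (auto simp: induced_edges_def cross_edges_def)
    finally have "card ?X + (\<Sum>q\<in>Q. card (induced_edges E (?fib q))) + d \<le> d * card ?W"
      using sparse[OF True] by linarith
    also have "d * card ?W = (\<Sum>q\<in>Q. d * card (?fib q))"
    proof -
      have "?W = (\<Union>q\<in>Q. ?fib q)" by auto
      then have "card ?W = (\<Sum>q\<in>Q. card (?fib q))"
        using finQ assms(1) by (simp only:) (intro card_UN_disjoint; auto)
      then show ?thesis by (simp add: sum_distrib_left)
    qed
    also have "\<dots> \<le> (\<Sum>q\<in>Q. card (induced_edges E (?fib q)) + d)"
      using dense by (intro sum_mono) blast
    also have "\<dots> = (\<Sum>q\<in>Q. card (induced_edges E (?fib q))) + d * card Q"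
      by (simp add: sum.distrib)
    finally show ?thesis by linarith
  qed
qed

text \<open>The rank condition of the matroid partition theorem, obtained by summing the Nash-Williams condition
over the components of \<open>F\<close>: these are unions of fibres, and a component of \<open>k\<close> fibres contributes
\<open>k - 1\<close> to the rank.\<close>

lemma card_cross_edges_le_rank:
  assumes "finite V" "E \<subseteq> nsets V 2" "F \<subseteq> cross_edges \<pi> E"
    and dense: "\<And>q. q \<in> \<pi> ` V \<Longrightarrow>
      d * card (V \<inter> \<pi> -` {q}) \<le> card (induced_edges E (V \<inter> \<pi> -` {q})) + d"
    and sparse: "\<And>Q. Q \<subseteq> \<pi> ` V \<Longrightarrow> card Q \<ge> 2 \<Longrightarrow>
      card (induced_edges E (V \<inter> \<pi> -` Q)) + d \<le> d * card (V \<inter> \<pi> -` Q)"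
  shows "card F \<le> d * contracted_rank V \<pi> F"
proof -
  let ?\<C> = "component V \<pi> F ` V"
  have FE: "F \<subseteq> E" using assms(3) by (auto simp: cross_edges_def)
  have finE: "finite E" using assms(1,2) finite_imp_finite_nsets finite_subset by blast
  then have finF: "finite F" using FE finite_subset by blast
  have closed: "v \<in> K" if K: "K \<in> ?\<C>" "u \<in> K" "v \<in> V" "\<pi> u = \<pi> v" for K u v
  proof -
    obtain x where x: "x \<in> V" "K = component V \<pi> F x" using K(1) by blast
    then have "u \<in> V" using K(2) component_subset by fast
    then have "(u, v) \<in> linked V \<pi> F" using K(3,4) by (intro linked_label)
    moreover have "(x, u) \<in> linked V \<pi> F" using K(2) by (simp add: x(2) component_def)
    ultimately show ?thesis by (simp add: x(2) component_def) (rule linked_trans)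
  qed
  have sub: "K \<subseteq> V" if "K \<in> ?\<C>" for K using that component_subset by fast
  have self: "v \<in> component V \<pi> F v" for v by (simp add: component_def linked_refl)
  have nonempty: "K \<noteq> {}" if K: "K \<in> ?\<C>" for K
  proof -
    obtain x where "K = component V \<pi> F x" using K by blast
    then show ?thesis using self[of x] by blast
  qed
  have disj: "K = K'" if K: "K \<in> ?\<C>" "K' \<in> ?\<C>" "v \<in> K" "v \<in> K'" for K K' v
  proof -
    obtain x y where x: "K = component V \<pi> F x" and y: "K' = component V \<pi> F y"
      using K(1,2) by blast
    have "(x, v) \<in> linked V \<pi> F" "(y, v) \<in> linked V \<pi> F"
      using K(3,4) unfolding x y component_def by blast+
    then show ?thesis unfolding x y component_eq_iff by (rule linked_trans[OF _ linked_sym])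
  qed
  have "card F + d * card ?\<C> \<le> (\<Sum>K\<in>?\<C>. card (induced_edges F K)) + d * card ?\<C>"
  proof -
    have "F \<subseteq> (\<Union>K\<in>?\<C>. induced_edges F K)"
    proof
      fix e assume e: "e \<in> F"
      then have "e \<in> nsets V 2" using FE assms(2) by blast
      then obtain u v where uv: "e = {u, v}" "u \<in> V" "v \<in> V"
        by (elim nsets2_E)
      then have "e \<subseteq> component V \<pi> F u"
        using e self[of u] linked_edge[of u V v F \<pi>] by (simp add: component_def)
      then have "e \<in> induced_edges F (component V \<pi> F u)"
        using e by (simp add: induced_edges_def)
      then show "e \<in> (\<Union>K\<in>?\<C>. induced_edges F K)" using uv(2) by blast
    qed
    then have "card F \<le> card (\<Union>K\<in>?\<C>. induced_edges F K)"
      using finF assms(1) by (intro card_mono) (auto simp: induced_edges_def)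
    also have "\<dots> \<le> (\<Sum>K\<in>?\<C>. card (induced_edges F K))"
      using assms(1) by (intro card_UN_le) simp
    finally show ?thesis by simp
  qed
  also have "\<dots> = (\<Sum>K\<in>?\<C>. card (induced_edges F K) + d)"
    by (simp add: sum.distrib)
  also have "\<dots> \<le> (\<Sum>K\<in>?\<C>. d * card (\<pi> ` K))"
  proof (rule sum_mono)
    fix K assume K: "K \<in> ?\<C>"
    have eq: "V \<inter> \<pi> -` (\<pi> ` K) = K"
    proof
      show "V \<inter> \<pi> -` (\<pi> ` K) \<subseteq> K"
      proof
        fix v assume "v \<in> V \<inter> \<pi> -` (\<pi> ` K)"
        then obtain u where "v \<in> V" "u \<in> K" "\<pi> u = \<pi> v" by fastforce
        then show "v \<in> K" using closed[OF K] by simp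
      qed
    qed (use sub[OF K] in blast)
    have "card (induced_edges (cross_edges \<pi> E) (V \<inter> \<pi> -` (\<pi> ` K))) + d \<le> d * card (\<pi> ` K)"
    proof (rule card_cross_edges_fibres[OF assms(1,2)])
      show "\<pi> ` K \<subseteq> \<pi> ` V" using sub[OF K] by blast
      show "\<pi> ` K \<noteq> {}" using nonempty[OF K] by blast
      show "d * card (V \<inter> \<pi> -` {q}) \<le> card (induced_edges E (V \<inter> \<pi> -` {q})) + d"
        if "q \<in> \<pi> ` K" for q
        by (rule dense) (rule subsetD[OF image_mono[OF sub[OF K]] that])
      show "card (induced_edges E (V \<inter> \<pi> -` \<pi> ` K)) + d \<le> d * card (V \<inter> \<pi> -` \<pi> ` K)"
        if "card (\<pi> ` K) \<ge> 2"
        by (rule sparse[OF image_mono[OF sub[OF K]] that])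
    qed
    moreover have "card (induced_edges F K) \<le> card (induced_edges (cross_edges \<pi> E) K)"
    proof (rule card_mono)
      show "finite (induced_edges (cross_edges \<pi> E) K)"
        by (rule finite_subset[OF _ finE]) (auto simp: induced_edges_def cross_edges_def)
      show "induced_edges F K \<subseteq> induced_edges (cross_edges \<pi> E) K"
        using assms(3) by (auto simp: induced_edges_def)
    qed
    ultimately show "card (induced_edges F K) + d \<le> d * card (\<pi> ` K)" unfolding eq by linarith
  qed
  also have "\<dots> = d * card (\<pi> ` V)"
  proof -
    have "card (\<Union>K\<in>?\<C>. \<pi> ` K) = (\<Sum>K\<in>?\<C>. card (\<pi> ` K))"
    proof (rule card_UN_disjoint)
      show "\<forall>K\<in>?\<C>. finite (\<pi> ` K)"
        by (intro ballI finite_imageI) (rule finite_subset[OF sub assms(1)])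
      show "\<forall>K\<in>?\<C>. \<forall>K'\<in>?\<C>. K \<noteq> K' \<longrightarrow> \<pi> ` K \<inter> \<pi> ` K' = {}"
      proof (intro ballI impI, rule ccontr)
        fix K K' assume K: "K \<in> ?\<C>" "K' \<in> ?\<C>" "K \<noteq> K'" "\<pi> ` K \<inter> \<pi> ` K' \<noteq> {}"
        then obtain u v where "u \<in> K" "v \<in> K'" "\<pi> u = \<pi> v" by auto
        then have "v \<in> K" using closed[OF K(1)] sub[OF K(2)] by blast
        then show False using disj[OF K(1,2)] K(3) \<open>v \<in> K'\<close> by blast
      qed
    qed (use assms(1) in simp)
    moreover have "(\<Union>K\<in>?\<C>. \<pi> ` K) = \<pi> ` V"
    proof
      show "\<pi> ` V \<subseteq> (\<Union>K\<in>?\<C>. \<pi> ` K)"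
      proof (rule image_subsetI)
        fix v assume "v \<in> V"
        then show "\<pi> v \<in> (\<Union>K\<in>?\<C>. \<pi> ` K)"
          by (rule UN_I[OF imageI]) (rule imageI[OF self])
      qed
      show "(\<Union>K\<in>?\<C>. \<pi> ` K) \<subseteq> \<pi> ` V"
        by (intro UN_least image_mono) (rule sub)
    qed
    ultimately show ?thesis by (simp add: sum_distrib_left)
  qed
  finally show ?thesis
    by (simp add: contracted_rank_def diff_mult_distrib2)
qed

text \<open>Take a labelling with the least number of labels among those whose fibres all satisfy \<open>D\<close>. If a
union of several fibres satisfied \<open>D\<close>, merging these fibres would give fewer labels.\<close>

lemma exists_condensing_labelling:
  assumes "finite V" "\<And>v. v \<in> V \<Longrightarrow> D {v}"
  shows "\<exists>\<pi>::'a \<Rightarrow> 'a. (\<forall>q\<in>\<pi> ` V. D (V \<inter> \<pi> -` {q})) \<and>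
    (\<forall>Q\<subseteq>\<pi> ` V. card Q \<ge> 2 \<longrightarrow> \<not> D (V \<inter> \<pi> -` Q))"
proof -
  let ?P = "\<lambda>\<pi>::'a \<Rightarrow> 'a. \<forall>q\<in>\<pi> ` V. D (V \<inter> \<pi> -` {q})"
  have "?P id" using assms(2) by (simp add: Int_insert_right)
  then obtain \<pi> where \<pi>: "?P \<pi>" "\<And>\<rho>. ?P \<rho> \<Longrightarrow> card (\<pi> ` V) \<le> card (\<rho> ` V)"
    using ex_has_least_nat[of ?P id "\<lambda>\<pi>. card (\<pi> ` V)"] by blast
  have "\<not> D (V \<inter> \<pi> -` Q)" if Q: "Q \<subseteq> \<pi> ` V" "card Q \<ge> 2" for Q
  proof
    assume D: "D (V \<inter> \<pi> -` Q)"
    have finQ: "finite Q" using Q(1) assms(1) finite_subset by blast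
    obtain q where q: "q \<in> Q" using Q(2) by fastforce
    define \<rho> where "\<rho> v = (if \<pi> v \<in> Q then q else \<pi> v)" for v
    have image: "\<rho> ` V \<subseteq> \<pi> ` V - (Q - {q})" using q Q(1) by (auto simp: \<rho>_def)
    have "?P \<rho>"
    proof
      fix p assume p: "p \<in> \<rho> ` V"
      show "D (V \<inter> \<rho> -` {p})"
      proof (cases "p = q")
        case True
        have "V \<inter> \<rho> -` {p} = V \<inter> \<pi> -` Q" using True q by (auto simp: \<rho>_def split: if_splits)
        then show ?thesis using D by simp
      next
        case False
        have "V \<inter> \<rho> -` {p} = V \<inter> \<pi> -` {p}" using False p image by (auto simp: \<rho>_def split: if_splits)
        then show ?thesis using \<pi>(1) p image by auto
      qed
    qed
    then have "card (\<pi> ` V) \<le> card (\<rho> ` V)" by (rule \<pi>(2))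
    also have "\<dots> \<le> card (\<pi> ` V - (Q - {q}))"
      using assms(1) image by (intro card_mono) auto
    also have "\<dots> = card (\<pi> ` V) - card (Q - {q})"
      using finQ Q(1) by (intro card_Diff_subset) auto
    finally have "card (\<pi> ` V) \<le> card (\<pi> ` V) - card (Q - {q})" .
    moreover have "card (Q - {q}) > 0" using Q(2) q finQ by simp
    moreover have "card (\<pi> ` V) > 0" using Q(1) q assms(1) by (auto simp: card_gt_0_iff)
    ultimately show False by linarith
  qed
  then show ?thesis using \<pi>(1) by blast
qed

text \<open>The classes of \<open>c\<close> are forests in the contracted multigraph, which is expressed by the bound on the
number of edges of a class inside \<open>T\<close> in terms of the number of labels that \<open>T\<close> meets.\<close>

lemma sparse_cross_edges_decomposition:
  assumes "finite V" "E \<subseteq> nsets V 2"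
    and dense: "\<And>q. q \<in> \<pi> ` V \<Longrightarrow>
      d * card (V \<inter> \<pi> -` {q}) \<le> card (induced_edges E (V \<inter> \<pi> -` {q})) + d"
    and sparse: "\<And>Q. Q \<subseteq> \<pi> ` V \<Longrightarrow> card Q \<ge> 2 \<Longrightarrow>
      card (induced_edges E (V \<inter> \<pi> -` Q)) + d \<le> d * card (V \<inter> \<pi> -` Q)"
  shows "\<exists>c. (\<forall>e\<in>cross_edges \<pi> E. c e < d) \<and>
    (\<forall>i T. T \<subseteq> V \<longrightarrow> T \<noteq> {} \<longrightarrow>
      card {e \<in> cross_edges \<pi> E. e \<subseteq> T \<and> c e = i} < card (\<pi> ` T))"
proof -
  let ?r = "contracted_rank V \<pi>"
  have fin: "finite (cross_edges \<pi> E)"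
    by (rule finite_subset[OF _ finite_imp_finite_nsets[OF assms(1)]])
      (use assms(2) in \<open>auto simp: cross_edges_def\<close>)
  have "card F \<le> (\<Sum>i<d. ?r F)" if "F \<subseteq> cross_edges \<pi> E" for F
    using card_cross_edges_le_rank[OF assms(1,2) that dense sparse] by simp
  from matroid_partition[OF fin rank_function_contracted_rank[OF assms(1)] this]
  obtain c where c: "\<forall>e\<in>cross_edges \<pi> E. c e < d"
    "\<forall>i<d. ?r {e\<in>cross_edges \<pi> E. c e = i} = card {e\<in>cross_edges \<pi> E. c e = i}"
    by blast
  show ?thesis
  proof (intro exI[of _ c] conjI ballI allI impI)
    show "c e < d" if "e \<in> cross_edges \<pi> E" for e using c(1) that by blast
    fix i T
    assume T: "T \<subseteq> V" "T \<noteq> {}"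
    let ?J = "{e \<in> cross_edges \<pi> E. e \<subseteq> T \<and> c e = i}"
    have "card ?J = ?r ?J"
    proof (cases "?J = {}")
      case True
      show ?thesis unfolding True
        using rank_functionD(1)[OF rank_function_contracted_rank[OF assms(1)]] by simp
    next
      case False
      then have "i < d" using c(1) by blast
      have "?r ?J = card ?J"
      proof (rule independent_subset[OF rank_function_contracted_rank[OF assms(1)]])
        show "?r {e\<in>cross_edges \<pi> E. c e = i} = card {e\<in>cross_edges \<pi> E. c e = i}"
          using c(2) \<open>i < d\<close> by blast
      qed (use fin in auto)
      then show ?thesis by simp
    qed
    also have "\<dots> < card (\<pi> ` T)"
      by (intro contracted_rank_less[OF assms(1) T]) blast
    finally show "card ?J < card (\<pi> ` T)" .
  qed
qed

section \<open>Pairs of a biclique that are separated by a partition\<close>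

text \<open>With \<open>\<alpha> = a - 1\<close> and \<open>\<mu> = m - 1\<close>, and \<open>z\<close> replaced by its upper bound \<open>\<beta>\<close>, the inequality becomes
\<open>\<alpha>\<mu> < \<beta> + \<mu>\<beta>'\<close>. The main case is \<open>\<beta>' < \<alpha>\<close>. There the inequality is strongest at the
extreme value \<open>\<mu> = \<alpha>\<close>, where it follows from \<open>\<beta> + \<beta>' > \<alpha>\<^sup>2\<close>.\<close>

lemma cross_pairs_arith:
  fixes a b \<beta> \<beta>' m z :: nat
  assumes "a \<ge> 2" "b \<ge> (a - 1)^2 + 1" "\<beta> + \<beta>' = b" "1 \<le> m" "m \<le> a" "z \<le> \<beta>" "2 \<le> m + z"
  shows "(a - 1) * (m + z - 1) < a * \<beta> + (m - 1) * \<beta>'"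
proof -
  obtain \<alpha> where \<alpha>: "a = Suc \<alpha>" "1 \<le> \<alpha>" using assms(1) by (cases a) auto
  obtain \<mu> where \<mu>: "m = Suc \<mu>" "\<mu> \<le> \<alpha>" using assms(4,5) \<alpha> by (cases m) auto
  have b: "\<alpha> * \<alpha> + 1 \<le> \<beta> + \<beta>'" using assms(2,3) \<alpha> by (simp add: power2_eq_square)
  have z: "\<alpha> * z \<le> \<alpha> * \<beta>" using assms(6) by simp
  have "\<alpha> * \<mu> < \<beta> + \<mu> * \<beta>'" if "1 \<le> \<mu>"
  proof (cases "\<alpha> \<le> \<beta>'")
    case True
    show ?thesis
    proof (cases "\<beta> = 0")
      case True
      then have "\<alpha> < \<beta>'" using b \<alpha>(2) by (metis Suc_eq_plus1 Suc_le_lessD add_0 le_less_trans le_square)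
      moreover have "\<mu> * \<alpha> < \<mu> * \<beta>'" using that \<open>\<alpha> < \<beta>'\<close> by simp
      ultimately show ?thesis using mult.commute[of \<alpha> \<mu>] by linarith
    next
      case False
      have "\<mu> * \<alpha> \<le> \<mu> * \<beta>'" using True by simp
      then show ?thesis using False mult.commute[of \<alpha> \<mu>] by linarith
    qed
  next
    case False
    then obtain k where k: "\<alpha> = \<beta>' + k" by (metis nat_le_iff_add nat_le_linear)
    have "\<mu> * k \<le> \<alpha> * k" using \<mu>(2) by simp
    moreover have "\<alpha> * \<alpha> = \<alpha> * \<beta>' + \<alpha> * k" unfolding k by (simp add: algebra_simps)
    moreover have "\<beta>' \<le> \<alpha> * \<beta>'" using \<alpha>(2) by simp
    ultimately have "\<mu> * k < \<beta>" using b by linarith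
    then show ?thesis by (simp add: k algebra_simps)
  qed
  moreover have "0 < \<beta>" if "\<mu> = 0" using that assms(6,7) \<mu> by simp
  ultimately have "\<alpha> * \<mu> < \<beta> + \<mu> * \<beta>'" by (cases "\<mu> = 0") auto
  then have "\<alpha> * \<mu> + \<alpha> * z < \<beta> + \<alpha> * \<beta> + \<mu> * \<beta>'" using z by linarith
  then show ?thesis by (simp add: \<alpha> \<mu> algebra_simps)
qed

text \<open>Let \<open>B'\<close> be the set of the elements of \<open>B\<close> that share a label with some element of \<open>A\<close>, and let \<open>A\<close> have
\<open>m\<close> labels. An element of \<open>B - B'\<close> is separated from all of \<open>A\<close>, an element of \<open>B'\<close> from at least
\<open>m - 1\<close> elements of \<open>A\<close>. There are at most \<open>card (B - B')\<close> labels besides those of \<open>A\<close>, and the claim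
reduces to an inequality between numbers.\<close>

lemma biclique_cross_pairs:
  assumes "finite A" "finite B" "card A = a" "card B = b" "a \<ge> 2" "b \<ge> (a - 1)^2 + 1"
    and "card (\<pi> ` (A \<union> B)) \<ge> 2"
  shows "(a - 1) * (card (\<pi> ` (A \<union> B)) - 1) < card {(x, y) \<in> A \<times> B. \<pi> x \<noteq> \<pi> y}"
proof -
  define B' where "B' = {y \<in> B. \<pi> y \<in> \<pi> ` A}"
  let ?m = "card (\<pi> ` A)" and ?z = "card (\<pi> ` (B - B'))"
  have B': "B' \<subseteq> B" "finite B'" "finite (B - B')" using assms(2) by (auto simp: B'_def)
  have "card (B - B') + card B' = b"
    using assms(2,4) B' card_mono[OF assms(2) B'(1)] by (simp add: card_Diff_subset)
  moreover have "1 \<le> ?m" using assms(1,3,5) by (auto simp: Suc_le_eq card_gt_0_iff)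
  moreover have "?m \<le> a" using assms(1,3) card_image_le by blast
  moreover have "?z \<le> card (B - B')" using B' card_image_le by blast
  moreover have le: "card (\<pi> ` (A \<union> B)) \<le> ?m + ?z"
  proof -
    have "\<pi> ` (A \<union> B) \<subseteq> \<pi> ` A \<union> \<pi> ` (B - B')" by (auto simp: B'_def)
    then have "card (\<pi> ` (A \<union> B)) \<le> card (\<pi> ` A \<union> \<pi> ` (B - B'))"
      using assms(1,2) by (intro card_mono) auto
    then show ?thesis using card_Un_le le_trans by blast
  qed
  ultimately have "(a - 1) * (?m + ?z - 1) < a * card (B - B') + (?m - 1) * card B'"
    using assms(5-7) by (intro cross_pairs_arith) auto
  moreover have "(a - 1) * (card (\<pi> ` (A \<union> B)) - 1) \<le> (a - 1) * (?m + ?z - 1)"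
    using le by (intro mult_le_mono2 diff_le_mono)
  moreover have "a * card (B - B') + (?m - 1) * card B' \<le> card {(x, y) \<in> A \<times> B. \<pi> x \<noteq> \<pi> y}"
  proof -
    let ?N = "\<lambda>y. {x \<in> A. \<pi> x \<noteq> \<pi> y}"
    have 1: "card (?N y) = a" if "y \<in> B - B'" for y
    proof -
      have "\<pi> y \<notin> \<pi> ` A" using that by (auto simp: B'_def)
      then have "?N y = A" by (auto simp: image_iff)
      then show ?thesis using assms(3) by simp
    qed
    have 2: "?m - 1 \<le> card (?N y)" for y
    proof -
      have "\<pi> ` A \<subseteq> insert (\<pi> y) (\<pi> ` ?N y)" by auto
      then have "?m \<le> card (insert (\<pi> y) (\<pi> ` ?N y))"
        using assms(1) by (intro card_mono) auto
      also have "\<dots> \<le> Suc (card (\<pi> ` ?N y))" by (rule card_insert_le_m1) auto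
      also have "card (\<pi> ` ?N y) \<le> card (?N y)" using assms(1) by (intro card_image_le) auto
      finally show ?thesis by simp
    qed
    have "a * card (B - B') + (?m - 1) * card B' = (\<Sum>y\<in>B - B'. a) + (\<Sum>y\<in>B'. ?m - 1)"
      by simp
    also have "\<dots> \<le> (\<Sum>y\<in>B - B'. card (?N y)) + (\<Sum>y\<in>B'. card (?N y))"
      using 1 2 by (intro add_mono sum_mono) auto
    also have "\<dots> = (\<Sum>y\<in>B. card (?N y))"
      using sum.subset_diff[OF B'(1) assms(2), of "\<lambda>y. card (?N y)"] by simp
    also have "\<dots> = card (SIGMA y:B. ?N y)"
      using assms(1,2) by (subst card_SigmaI) auto
    also have "\<dots> = card {(x, y) \<in> A \<times> B. \<pi> x \<noteq> \<pi> y}"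
      by (rule bij_betw_same_card[of prod.swap]) (auto simp: bij_betw_def inj_on_def image_iff)
    finally show ?thesis .
  qed
  ultimately show ?thesis by linarith
qed

section \<open>Ramsey graphs for bicliques\<close>

definition mono_biclique :: "'a ugraph \<Rightarrow> nat \<Rightarrow> nat \<Rightarrow> ('a set \<Rightarrow> nat) \<Rightarrow> nat \<Rightarrow> 'a set \<Rightarrow> 'a set \<Rightarrow> bool" where
  "mono_biclique G a b c k A B \<longleftrightarrow> A \<subseteq> verts G \<and> B \<subseteq> verts G \<and> A \<inter> B = {} \<and> card A = a \<and> card B = b \<and>
     (\<forall>x\<in>A. \<forall>y\<in>B. {x, y} \<in> edges G \<and> c {x, y} = k)"

lemma biclique_of_iso:
  assumes "subgraph H G" "graph_iso (complete_bipartite a b) H" "\<forall>e\<in>edges H. c e = k"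
  shows "\<exists>A B. mono_biclique G a b c k A B"
proof -
  let ?L = "Inl ` {..<a} :: (nat + nat) set" and ?R = "Inr ` {..<b} :: (nat + nat) set"
  obtain f where f: "bij_betw f (?L \<union> ?R) (verts H)"
    and E: "edges H = (\<lambda>e. f ` e) ` {{Inl i, Inr j} | i j. i < a \<and> j < b}"
    using assms(2) by (auto simp: graph_iso_def complete_bipartite_def Plus_def)
  have inj: "inj_on f (?L \<union> ?R)" and V: "f ` (?L \<union> ?R) = verts H"
    using f by (auto simp: bij_betw_def)
  have "mono_biclique G a b c k (f ` ?L) (f ` ?R)"
    unfolding mono_biclique_def
  proof (intro conjI ballI)
    show "f ` ?L \<subseteq> verts G" "f ` ?R \<subseteq> verts G"
      using V assms(1) by (auto simp: subgraph_def)
    show "f ` ?L \<inter> f ` ?R = {}"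
      using inj by (subst inj_on_image_Int[OF inj, symmetric]) auto
    show "card (f ` ?L) = a" "card (f ` ?R) = b"
      using inj by (simp_all add: card_image inj_on_subset)
    fix x y assume "x \<in> f ` ?L" "y \<in> f ` ?R"
    then obtain i j where "i < a" "j < b" "x = f (Inl i)" "y = f (Inr j)" by blast
    then have "{x, y} = f ` {Inl i, Inr j}" "i < a" "j < b" by simp_all
    then have "{x, y} \<in> edges H" unfolding E by blast
    then show "{x, y} \<in> edges G" "c {x, y} = k"
      using assms(1,3) by (auto simp: subgraph_def)
  qed
  then show ?thesis by blast
qed

lemma iso_of_biclique:
  assumes "mono_biclique G a b c k A B" "1 \<le> a" "1 \<le> b"
  shows "\<exists>H. subgraph H G \<and> graph_iso (complete_bipartite a b) H \<and> (\<forall>e\<in>edges H. c e = k)"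
proof -
  let ?H = "(A \<union> B, {{x, y} | x y. x \<in> A \<and> y \<in> B})"
  note AB = assms(1)[unfolded mono_biclique_def]
  have fin: "finite A" "finite B" using AB assms(2,3) by (auto intro: card_ge_0_finite)
  obtain g where g: "bij_betw g {..<a} A"
    using finite_same_card_bij[of "{..<a}" A] fin AB by auto
  obtain h where h: "bij_betw h {..<b} B"
    using finite_same_card_bij[of "{..<b}" B] fin AB by auto
  have "bij_betw (case_sum g h) (Inl ` {..<a} \<union> Inr ` {..<b}) (A \<union> B)"
  proof (rule bij_betw_combine)
    show "bij_betw (case_sum g h) (Inl ` {..<a}) A" "bij_betw (case_sum g h) (Inr ` {..<b}) B"
      using g h by (auto simp: bij_betw_def inj_on_def image_image)
  qed (use AB in blast)
  moreover have "{{x, y} | x y. x \<in> A \<and> y \<in> B}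
      = (\<lambda>e. case_sum g h ` e) ` {{Inl i, Inr j} | i j. i < a \<and> j < b}" (is "?E = ?I")
  proof
    show "?E \<subseteq> ?I"
    proof
      fix e assume "e \<in> ?E"
      then obtain i j where "i < a" "j < b" "e = {g i, h j}"
        using g h by (auto simp: bij_betw_def)
      then have "e = case_sum g h ` {Inl i, Inr j}" "i < a" "j < b" by simp_all
      then show "e \<in> ?I" by blast
    qed
    show "?I \<subseteq> ?E"
    proof
      fix e assume "e \<in> ?I"
      then obtain i j where "i < a" "j < b" "e = {g i, h j}" by auto
      moreover from this have "g i \<in> A" "h j \<in> B" using g h by (auto simp: bij_betw_def)
      ultimately show "e \<in> ?E" by blast
    qed
  qed
  ultimately have "graph_iso (complete_bipartite a b) ?H"
    unfolding graph_iso_def complete_bipartite_def Plus_def fst_conv snd_conv by blast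
  moreover have "subgraph ?H G"
    using AB fin by (auto simp: subgraph_def simple_graph_def)
  moreover have "\<forall>e\<in>edges ?H. c e = k" using AB by auto
  ultimately show ?thesis by blast
qed

text \<open>Replaces subgraphs isomorphic to the complete bipartite graph by their two sides. For \<open>a = 0\<close> or
\<open>b = 0\<close> a side of cardinality \<open>0\<close> might be infinite, whence the restriction to positive sizes.\<close>

lemma is_ramsey_complete_bipartite_iff:
  assumes "1 \<le> a" "1 \<le> b"
  shows "is_ramsey (complete_bipartite a b) r G \<longleftrightarrow>
    (\<forall>c. (\<forall>e\<in>edges G. c e < r) \<longrightarrow> (\<exists>k<r. \<exists>A B. mono_biclique G a b c k A B))"
proof -
  have "(\<exists>H k. subgraph H G \<and> graph_iso (complete_bipartite a b) H \<and> k < r \<and> (\<forall>e\<in>edges H. c e = k))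
      \<longleftrightarrow> (\<exists>k<r. \<exists>A B. mono_biclique G a b c k A B)" (is "?L \<longleftrightarrow> ?R") for c
  proof
    assume ?L
    then show ?R using biclique_of_iso by blast
  next
    assume ?R
    then show ?L using iso_of_biclique[OF _ assms] by blast
  qed
  then show ?thesis unfolding is_ramsey_def by simp
qed

text \<open>The Ramsey number being defined as a minimum, a smaller complete graph has a good
colouring, which is transported along a bijection of the vertices.\<close>

lemma not_ramsey_below_ramsey_number:
  assumes "finite W" "card W < ramsey_number (complete_bipartite a b) r" "1 \<le> a" "1 \<le> b"
  shows "\<not> is_ramsey (complete_bipartite a b) r (W, nsets W 2)"
proof -
  have "\<not> is_ramsey (complete_bipartite a b) r (complete_graph (card W))"
    using assms(2) unfolding ramsey_number_def by (rule not_less_Least)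
  then obtain c where c: "\<forall>e\<in>nsets {..<card W} 2. c e < r"
    "\<And>k A B. k < r \<Longrightarrow> \<not> mono_biclique (complete_graph (card W)) a b c k A B"
    unfolding is_ramsey_complete_bipartite_iff[OF assms(3,4)]
    by (auto simp: complete_graph_def)
  obtain h where h: "bij_betw h W {..<card W}"
    using finite_same_card_bij[of W "{..<card W}"] assms(1) by auto
  have inj: "inj_on h W" and im: "h ` W = {..<card W}" using h by (auto simp: bij_betw_def)
  have edge: "{h x, h y} \<in> nsets {..<card W} 2" if "{x, y} \<in> nsets W 2" for x y
  proof -
    have "x \<in> W" "y \<in> W" "x \<noteq> y" using that by simp_all
    then show ?thesis using inj im by (auto simp: inj_on_eq_iff)
  qed
  define c' where "c' e = c (h ` e)" for e
  have "\<not> mono_biclique (W, nsets W 2) a b c' k A B" if "k < r" for k A B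
  proof
    assume "mono_biclique (W, nsets W 2) a b c' k A B"
    then have AB: "A \<subseteq> W" "B \<subseteq> W" "A \<inter> B = {}" "card A = a" "card B = b"
      "\<And>x y. x \<in> A \<Longrightarrow> y \<in> B \<Longrightarrow> {x, y} \<in> nsets W 2 \<and> c' {x, y} = k"
      by (auto simp: mono_biclique_def)
    have "mono_biclique (complete_graph (card W)) a b c k (h ` A) (h ` B)"
      unfolding mono_biclique_def complete_graph_def fst_conv snd_conv
    proof (intro conjI ballI)
      show "h ` A \<subseteq> {..<card W}" "h ` B \<subseteq> {..<card W}" using AB(1,2) im by blast+
      show "h ` A \<inter> h ` B = {}" using inj_on_image_Int[OF inj AB(1,2)] AB(3) by simp
      show "card (h ` A) = a" "card (h ` B) = b"
        using AB inj by (metis card_image inj_on_subset)+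
      fix x y assume "x \<in> h ` A" "y \<in> h ` B"
      then obtain u v where uv: "u \<in> A" "v \<in> B" "x = h u" "y = h v" by blast
      show "{x, y} \<in> nsets {..<card W} 2" 
        unfolding uv(3,4) by (rule edge) (use AB(6)[OF uv(1,2)] in blast)
      show "c {x, y} = k" using AB(6)[OF uv(1,2)] uv(3,4) by (simp add: c'_def)
    qed
    then show False using c(2)[OF that] by blast
  qed
  moreover have "c' e < r" if e: "e \<in> nsets W 2" for e
  proof -
    obtain x y where xy: "e = {x, y}" using e by (elim nsets2_E)
    then have "{h x, h y} \<in> nsets {..<card W} 2" using e by (intro edge) blast
    then show ?thesis using c(1) unfolding c'_def xy by auto
  qed
  ultimately show ?thesis
    unfolding is_ramsey_complete_bipartite_iff[OF assms(3,4)] snd_conv by blast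
qed

text \<open>The core of the lower bound: only dense sets obstruct a good colouring. The condition on \<open>W\<close> says
that \<open>W\<close> spans more than \<open>d(card W - 1)\<close> edges, where \<open>d = r(a - 1)\<close>. Dense sets are coloured by
hypothesis, everything between them by forests.\<close>

theorem not_ramsey_if_dense_sets_not_ramsey:
  assumes G: "simple_graph G" and a: "a \<ge> 2" and b: "b \<ge> (a - 1)^2 + 1"
    and small: "\<And>W. W \<subseteq> verts G \<Longrightarrow> W \<noteq> {} \<Longrightarrow>
      r * (a - 1) * card W < card (induced_edges (edges G) W) + r * (a - 1) \<Longrightarrow>
      \<not> is_ramsey (complete_bipartite a b) r (W, nsets W 2)"
  shows "\<not> is_ramsey (complete_bipartite a b) r G"
proof
  assume ramsey: "is_ramsey (complete_bipartite a b) r G"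
  let ?V = "verts G" and ?E = "edges G" and ?d = "r * (a - 1)"
  have ab: "1 \<le> a" "1 \<le> b" using a b by auto
  have V: "finite ?V" and E: "?E \<subseteq> nsets ?V 2" using G by (auto simp: simple_graph_def)
  have finE: "finite ?E" using V E finite_imp_finite_nsets finite_subset by blast
  define D where "D W \<longleftrightarrow> card W = 1 \<or> ?d * card W < card (induced_edges ?E W) + ?d"
    for W :: "'a set"
  have "\<exists>\<pi>::'a \<Rightarrow> 'a. (\<forall>q\<in>\<pi> ` ?V. D (?V \<inter> \<pi> -` {q})) \<and>
      (\<forall>Q\<subseteq>\<pi> ` ?V. card Q \<ge> 2 \<longrightarrow> \<not> D (?V \<inter> \<pi> -` Q))"
    by (rule exists_condensing_labelling[OF V]) (simp add: D_def)
  then obtain \<pi> :: "'a \<Rightarrow> 'a"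
    where fibres: "\<forall>q\<in>\<pi> ` ?V. D (?V \<inter> \<pi> -` {q})"
      and unions: "\<forall>Q\<subseteq>\<pi> ` ?V. card Q \<ge> 2 \<longrightarrow> \<not> D (?V \<inter> \<pi> -` Q)"
    by (elim exE conjE)
  note \<pi>D = fibres[rule_format] and \<pi>S = unions[rule_format]
  let ?fib = "\<lambda>q. ?V \<inter> \<pi> -` {q}"
  have dense: "?d * card (?fib q) \<le> card (induced_edges ?E (?fib q)) + ?d" if "q \<in> \<pi> ` ?V" for q
    using \<pi>D[OF that] by (auto simp: D_def)
  have sparse: "card (induced_edges ?E (?V \<inter> \<pi> -` Q)) + ?d \<le> ?d * card (?V \<inter> \<pi> -` Q)"
    if "Q \<subseteq> \<pi> ` ?V" "card Q \<ge> 2" for Q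
    using \<pi>S[OF that] by (simp add: D_def)
  have "\<exists>c. (\<forall>e\<in>cross_edges \<pi> ?E. c e < ?d) \<and>
    (\<forall>i T. T \<subseteq> ?V \<longrightarrow> T \<noteq> {} \<longrightarrow>
      card {e \<in> cross_edges \<pi> ?E. e \<subseteq> T \<and> c e = i} < card (\<pi> ` T))"
    by (rule sparse_cross_edges_decomposition[OF V E]) (fact dense sparse)+
  then obtain c where c1: "\<forall>e\<in>cross_edges \<pi> ?E. c e < ?d"
    and c2: "\<forall>i T. T \<subseteq> ?V \<longrightarrow> T \<noteq> {} \<longrightarrow>
      card {e \<in> cross_edges \<pi> ?E. e \<subseteq> T \<and> c e = i} < card (\<pi> ` T)"
    by (elim exE conjE)
  note c_less = c1[rule_format] and c_card = c2[rule_format]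
  have "\<exists>c. (\<forall>e\<in>nsets (?fib q) 2. c e < r) \<and>
      (\<forall>k<r. \<forall>A B. \<not> mono_biclique (?fib q, nsets (?fib q) 2) a b c k A B)"
    if q: "q \<in> \<pi> ` ?V" for q
  proof -
    have "\<not> is_ramsey (complete_bipartite a b) r (?fib q, nsets (?fib q) 2)"
    proof (cases "card (?fib q) = 1")
      case True
      then have "\<not> mono_biclique (?fib q, nsets (?fib q) 2) a b c k A B" for c k A B
        using a card_mono[of "?fib q" A] V by (auto simp: mono_biclique_def)
      moreover have "nsets (?fib q) 2 = {}"
        using True V by (intro nsets_eq_empty) auto
      ultimately show ?thesis
        unfolding is_ramsey_complete_bipartite_iff[OF ab] snd_conv by blast
    next
      case False
      have "?fib q \<noteq> {}" using q by blast
      moreover have "?d * card (?fib q) < card (induced_edges ?E (?fib q)) + ?d"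
        using False \<pi>D[OF q] by (simp add: D_def)
      ultimately show ?thesis by (intro small) simp_all
    qed
    then show ?thesis
      unfolding is_ramsey_complete_bipartite_iff[OF ab] snd_conv by blast
  qed
  then have "\<forall>q\<in>\<pi> ` ?V. \<exists>c. (\<forall>e\<in>nsets (?fib q) 2. c e < r) \<and>
      (\<forall>k<r. \<forall>A B. \<not> mono_biclique (?fib q, nsets (?fib q) 2) a b c k A B)"
    by (rule ballI)
  from bchoice[OF this] obtain col
    where cols: "\<forall>q\<in>\<pi> ` ?V. (\<forall>e\<in>nsets (?fib q) 2. col q e < r) \<and>
      (\<forall>k<r. \<forall>A B. \<not> mono_biclique (?fib q, nsets (?fib q) 2) a b (col q) k A B)"
    by (elim exE)
  have col: "col q e < r" if "q \<in> \<pi> ` ?V" "e \<in> nsets (?fib q) 2" for q e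
    using bspec[OF cols that(1)] that(2) by blast
  have col_free: "\<not> mono_biclique (?fib q, nsets (?fib q) 2) a b (col q) k A B"
    if "q \<in> \<pi> ` ?V" "k < r" for q k A B
    using bspec[OF cols that(1)] that(2) by blast
  \<comment> \<open>Colour \<open>k\<close> receives the forests with index \<open>i\<close> such that \<open>i div (a - 1) = k\<close>. An edge that is
    not a cross edge has a single label, which determines the colouring that is used.\<close>
  define \<chi> where "\<chi> e = (if e \<in> cross_edges \<pi> ?E then c e div (a - 1)
    else col (the_elem (\<pi> ` e)) e)" for e
  have \<chi>_cross: "\<chi> e = c e div (a - 1)" if "e \<in> cross_edges \<pi> ?E" for e
    using that by (simp add: \<chi>_def)
  have \<chi>_fib: "\<chi> {x, y} = col (\<pi> x) {x, y}" if "\<pi> x = \<pi> y" for x y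
    using that by (auto simp: \<chi>_def cross_edges_def)
  have crossI: "{x, y} \<in> cross_edges \<pi> ?E" if "{x, y} \<in> ?E" "\<pi> x \<noteq> \<pi> y" for x y
    using that by (auto simp: cross_edges_def)
  have "\<chi> e < r" if e: "e \<in> ?E" for e
  proof -
    have "e \<in> nsets ?V 2" using e E by blast
    then obtain x y where xy: "e = {x, y}" "x \<in> ?V" "y \<in> ?V" "x \<noteq> y" by (elim nsets2_E)
    show ?thesis
    proof (cases "\<pi> x = \<pi> y")
      case True
      then have "{x, y} \<in> nsets (?fib (\<pi> x)) 2" using xy by simp
      then show ?thesis using col xy \<chi>_fib[OF True] by simp
    next
      case False
      then have "e \<in> cross_edges \<pi> ?E" using crossI e xy(1) by simp
      then show ?thesis
        unfolding \<chi>_cross[OF \<open>e \<in> cross_edges \<pi> ?E\<close>]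
        by (intro less_mult_imp_div_less c_less)
    qed
  qed
  then obtain k A B where k: "k < r" and biclique: "mono_biclique G a b \<chi> k A B"
    using ramsey unfolding is_ramsey_complete_bipartite_iff[OF ab] by blast
  then have AB: "A \<subseteq> ?V" "B \<subseteq> ?V" "A \<inter> B = {}" "card A = a" "card B = b"
    and edge: "\<And>x y. x \<in> A \<Longrightarrow> y \<in> B \<Longrightarrow> {x, y} \<in> ?E"
    and mono: "\<And>x y. x \<in> A \<Longrightarrow> y \<in> B \<Longrightarrow> \<chi> {x, y} = k"
    by (auto simp: mono_biclique_def)
  have fin: "finite A" "finite B" using AB(1,2) V finite_subset by blast+
  let ?T = "A \<union> B"
  have T: "?T \<subseteq> ?V" "?T \<noteq> {}" using AB ab by auto
  show False
  proof (cases "card (\<pi> ` ?T) \<ge> 2")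
    case True
    define P where "P = {(x, y) \<in> A \<times> B. \<pi> x \<noteq> \<pi> y}"
    define J where "J = (\<lambda>(x, y). {x, y}) ` P"
    have J: "J \<subseteq> cross_edges \<pi> ?E" using crossI edge by (auto simp: J_def P_def)
    have JT: "e \<subseteq> ?T" "c e div (a - 1) = k" if e: "e \<in> J" for e
    proof -
      obtain x y where xy: "e = {x, y}" "x \<in> A" "y \<in> B" using e by (auto simp: J_def P_def)
      then show "e \<subseteq> ?T" by blast
      show "c e div (a - 1) = k"
        using mono[OF xy(2,3)] \<chi>_cross[of e] J e xy(1) by auto
    qed
    have finJ: "finite J"
      by (rule finite_subset[OF _ finE]) (use J in \<open>auto simp: cross_edges_def\<close>)
    have "inj_on (\<lambda>(x, y). {x, y}) P"
      using AB(3) by (auto simp: inj_on_def P_def doubleton_eq_iff)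
    then have "card P = card J" by (simp add: J_def card_image)
    also have "\<dots> \<le> card (\<Union>i\<in>{k * (a - 1)..<Suc k * (a - 1)}. {e \<in> J. c e = i})"
    proof (intro card_mono)
      show "J \<subseteq> (\<Union>i\<in>{k * (a - 1)..<Suc k * (a - 1)}. {e \<in> J. c e = i})"
      proof
        fix e assume e: "e \<in> J"
        have "0 < a - 1" using a by simp
        then have "c e mod (a - 1) < a - 1" by simp
        moreover have "c e = k * (a - 1) + c e mod (a - 1)"
          using div_mult_mod_eq[of "c e" "a - 1"] JT(2)[OF e] by simp
        ultimately have "k * (a - 1) \<le> c e" "c e < Suc k * (a - 1)"
          unfolding mult_Suc by linarith+
        then have "c e \<in> {k * (a - 1)..<Suc k * (a - 1)}" by simp
        then show "e \<in> (\<Union>i\<in>{k * (a - 1)..<Suc k * (a - 1)}. {e \<in> J. c e = i})"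
          using e by blast
      qed
    qed (use finJ in auto)
    also have "\<dots> \<le> (\<Sum>i\<in>{k * (a - 1)..<Suc k * (a - 1)}. card {e \<in> J. c e = i})"
      by (intro card_UN_le) simp
    also have "\<dots> \<le> (\<Sum>i\<in>{k * (a - 1)..<Suc k * (a - 1)}. card (\<pi> ` ?T) - 1)"
    proof (rule sum_mono)
      fix i
      have "card {e \<in> J. c e = i} \<le> card {e \<in> cross_edges \<pi> ?E. e \<subseteq> ?T \<and> c e = i}"
        using J JT(1) by (intro card_mono finite_subset[OF _ finE]) (auto simp: cross_edges_def)
      also have "\<dots> < card (\<pi> ` ?T)" by (rule c_card[OF T])
      finally show "card {e \<in> J. c e = i} \<le> card (\<pi> ` ?T) - 1" by simp
    qed
    also have "\<dots> = (a - 1) * (card (\<pi> ` ?T) - 1)" by simp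
    also have "\<dots> < card P"
      unfolding P_def by (rule biclique_cross_pairs[OF fin AB(4,5) a b True])
    finally show False by simp
  next
    case False
    obtain t where t: "t \<in> ?T" using T(2) by blast
    have const: "\<pi> x = \<pi> t" if "x \<in> ?T" for x
    proof (rule ccontr)
      assume "\<pi> x \<noteq> \<pi> t"
      then have "card {\<pi> x, \<pi> t} = 2" by simp
      moreover have "card {\<pi> x, \<pi> t} \<le> card (\<pi> ` ?T)"
        using that t fin by (intro card_mono) auto
      ultimately show False using False by simp
    qed
    have "mono_biclique (?fib (\<pi> t), nsets (?fib (\<pi> t)) 2) a b (col (\<pi> t)) k A B"
      unfolding mono_biclique_def fst_conv snd_conv
    proof (intro conjI ballI)
      have "?T \<subseteq> \<pi> -` {\<pi> t}" using const by blast
      then show "A \<subseteq> ?fib (\<pi> t)" "B \<subseteq> ?fib (\<pi> t)" using AB(1,2) by blast+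
      fix x y assume xy: "x \<in> A" "y \<in> B"
      then have "\<pi> x = \<pi> t" "\<pi> y = \<pi> t" using const by blast+
      moreover have "x \<noteq> y" using xy AB(3) by blast
      ultimately show "{x, y} \<in> nsets (?fib (\<pi> t)) 2" using xy AB(1,2) by auto
      show "col (\<pi> t) {x, y} = k"
        using \<chi>_fib[of x y] mono[OF xy] \<open>\<pi> x = \<pi> t\<close> \<open>\<pi> y = \<pi> t\<close> by simp
    qed (use AB in auto)
    moreover have "\<pi> t \<in> \<pi> ` ?V" using t T(1) by blast
    ultimately show False using col_free k by blast
  qed
qed

section \<open>The density of Ramsey graphs\<close>

lemma finite_subgraph_densities:
  assumes "simple_graph G"
  shows "finite {real (card (edges H)) / real (card (verts H)) | H. subgraph H G \<and> verts H \<noteq> {}}"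
proof -
  have "finite (verts G)" "edges G \<subseteq> nsets (verts G) 2"
    using assms by (auto simp: simple_graph_def)
  then have "finite (Pow (verts G) \<times> Pow (edges G))"
    using finite_subset[OF _ finite_imp_finite_nsets] by blast
  moreover have "{H. subgraph H G \<and> verts H \<noteq> {}} \<subseteq> Pow (verts G) \<times> Pow (edges G)"
    by (auto simp: subgraph_def)
  ultimately have "finite {H. subgraph H G \<and> verts H \<noteq> {}}" by (rule finite_subset[rotated])
  then show ?thesis by (rule finite_image_set)
qed

lemma card_induced_edges_le_density:
  assumes "simple_graph G" "W \<subseteq> verts G" "W \<noteq> {}"
  shows "real (card (induced_edges (edges G) W)) \<le> max_density G * real (card W)"
proof -
  have fin: "finite W" using assms(1,2) finite_subset by (auto simp: simple_graph_def)
  have "subgraph (W, induced_edges (edges G) W) G"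
    using assms fin by (auto simp: subgraph_def simple_graph_def induced_edges_def nsets_def)
  then have "real (card (induced_edges (edges G) W)) / real (card W) \<in>
      {real (card (edges H)) / real (card (verts H)) | H. subgraph H G \<and> verts H \<noteq> {}}"
    using assms(3) by (intro CollectI exI[of _ "(W, induced_edges (edges G) W)"]) simp
  then have "real (card (induced_edges (edges G) W)) / real (card W) \<le> max_density G"
    unfolding max_density_def by (rule Max_ge[OF finite_subgraph_densities[OF assms(1)]])
  moreover have "card W > 0" using fin assms(3) by (simp add: card_gt_0_iff)
  ultimately show ?thesis by (simp add: pos_divide_le_eq)
qed

lemma card_induced_edges_le_choose:
  assumes "finite W" "E \<subseteq> nsets V 2"
  shows "2 * card (induced_edges E W) \<le> card W * (card W - 1)"
proof -
  have "induced_edges E W \<subseteq> {B. B \<subseteq> W \<and> card B = 2}"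
    using assms(2) by (auto simp: induced_edges_def nsets_def)
  then have "card (induced_edges E W) \<le> card {B. B \<subseteq> W \<and> card B = 2}"
    using assms(1) by (intro card_mono) auto
  then show ?thesis
    using assms(1) by (simp add: n_subsets choose_two)
qed

text \<open>If the density were smaller, a dense set \<open>W\<close> would have fewer than \<open>N\<close> vertices: for \<open>card W \<ge> N\<close>
the error term, multiplied by \<open>card W\<close>, is at least \<open>d - 1\<close>, so that \<open>W\<close> spans fewer than
\<open>d(card W) - (d - 1)\<close> edges and is not dense, by integrality. As \<open>W\<close> spans at most
\<open>card W (card W - 1) / 2\<close> edges, it also has more than \<open>2d\<close> vertices, and so \<open>card W\<close> is less than
the Ramsey number, whichever term attains the maximum.\<close>

lemma ramsey_graph_density_ge:
  assumes G: "simple_graph G" and ramsey: "is_ramsey (complete_bipartite a b) r G"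
    and a: "a \<ge> 2" and b: "b \<ge> (a - 1)^2 + 1" and d: "d = r * (a - 1)" "d \<ge> 1"
    and N: "N = max (ramsey_number (complete_bipartite a b) r) (2 * d + 1)"
  shows "real d - (real d - 1) / real N \<le> max_density G"
proof (rule ccontr)
  assume neg: "\<not> real d - (real d - 1) / real N \<le> max_density G"
  have "\<not> is_ramsey (complete_bipartite a b) r G"
  proof (rule not_ramsey_if_dense_sets_not_ramsey[OF G a b])
    fix W assume W: "W \<subseteq> verts G" "W \<noteq> {}"
      and "r * (a - 1) * card W < card (induced_edges (edges G) W) + r * (a - 1)"
    then have dense: "d * card W < card (induced_edges (edges G) W) + d" by (simp add: d)
    let ?e = "card (induced_edges (edges G) W)"
    have fin: "finite W" using G W(1) finite_subset by (auto simp: simple_graph_def)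
    obtain n where n: "card W = Suc n" using fin W(2) by (metis card_eq_0_iff not0_implies_Suc)
    have "2 * ?e \<le> Suc n * n"
      using card_induced_edges_le_choose[OF fin, of "edges G" "verts G"] G n
      by (simp add: simple_graph_def)
    then have "2 * d * n < Suc n * n" using dense n by simp
    then have "2 * d < Suc n" by (simp only: mult_less_cancel2)
    then have large: "2 * d + 1 \<le> card W" using n by simp
    have "card W < N"
    proof (rule ccontr)
      assume "\<not> card W < N"
      then have "real N \<le> real (card W)" by simp
      moreover have "real N > 0" using N by simp
      ultimately have "real d - 1 \<le> (real d - 1) / real N * real (card W)"
        using d(2) mult_left_mono[of "real N" "real (card W)" "real d - 1"]
        by (simp add: pos_le_divide_eq)
      moreover have "real ?e \<le> max_density G * real (card W)"
        by (rule card_induced_edges_le_density[OF G W])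
      moreover have "max_density G * real (card W) < (real d - (real d - 1) / real N) * real (card W)"
        using neg n by (intro mult_strict_right_mono) auto
      ultimately have "real ?e < real d * real (card W) - (real d - 1)"
        by (simp add: left_diff_distrib)
      then have "real (?e + d) < real (d * card W + 1)" by simp
      then show False using dense by linarith
    qed
    then have "card W < ramsey_number (complete_bipartite a b) r" using large N by simp
    then show "\<not> is_ramsey (complete_bipartite a b) r (W, nsets W 2)"
      using fin a b by (intro not_ramsey_below_ramsey_number) auto
  qed
  then show False using ramsey by contradiction
qed

definition bipartite_host :: "nat \<Rightarrow> nat \<Rightarrow> nat ugraph" where
  "bipartite_host s t = ({..<s + t}, {{i, j} | i j. i < s \<and> s \<le> j \<and> j < s + t})"

lemma simple_graph_bipartite_host: "simple_graph (bipartite_host s t)"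
  by (auto simp: simple_graph_def bipartite_host_def)

text \<open>A subgraph with \<open>p\<close> vertices on the side of size \<open>s\<close> and \<open>q\<close> on the other one has at most \<open>pq \<le> sq\<close>
edges, which is less than \<open>s(p + q)\<close> if \<open>p > 0\<close>; if \<open>p = 0\<close> there are no edges at all.\<close>

lemma max_density_bipartite_host_less:
  assumes "1 \<le> s"
  shows "max_density (bipartite_host s t) < real s"
proof -
  let ?G = "bipartite_host s t"
  let ?D = "{real (card (edges H)) / real (card (verts H)) | H. subgraph H ?G \<and> verts H \<noteq> {}}"
  have "x < real s" if "x \<in> ?D" for x
  proof -
    obtain H where H: "subgraph H ?G" "verts H \<noteq> {}"
      and x: "x = real (card (edges H)) / real (card (verts H))"
      using \<open>x \<in> ?D\<close> by blast
    have fin: "finite (verts H)" and EH: "edges H \<subseteq> nsets (verts H) 2"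
      and sub: "verts H \<subseteq> verts ?G" "edges H \<subseteq> edges ?G"
      using H(1) by (auto simp: subgraph_def simple_graph_def)
    let ?L = "{i \<in> verts H. i < s}" and ?R = "{j \<in> verts H. s \<le> j}"
    have "edges H \<subseteq> (\<lambda>(i, j). {i, j}) ` (?L \<times> ?R)"
    proof
      fix e assume e: "e \<in> edges H"
      then obtain i j where ij: "e = {i, j}" "i < s" "s \<le> j"
        using sub(2) by (auto simp: bipartite_host_def)
      then have "(i, j) \<in> ?L \<times> ?R" using e EH by auto
      then show "e \<in> (\<lambda>(i, j). {i, j}) ` (?L \<times> ?R)" unfolding ij(1) by (rule rev_image_eqI) simp
    qed
    then have "card (edges H) \<le> card (?L \<times> ?R)"
      using fin by (intro surj_card_le) auto
    then have e: "card (edges H) \<le> card ?L * card ?R" by (simp add: card_cartesian_product)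
    have split: "card (verts H) = card ?L + card ?R"
      using fin by (subst card_Un_disjoint[symmetric]) (auto intro: arg_cong[where f = card])
    have pos: "card (verts H) > 0" using fin H(2) by (simp add: card_gt_0_iff)
    have "card ?L \<le> card {..<s}" by (intro card_mono) auto
    then have "card ?L * card ?R \<le> s * card ?R" by simp
    then have "card ?L * card ?R < s * (card ?L + card ?R)"
    proof (cases "card ?L = 0")
      case True
      then have "card ?L * card ?R = 0" by simp
      moreover have "0 < s * (card ?L + card ?R)" using assms pos unfolding split by simp
      ultimately show ?thesis by linarith
    next
      case False
      then have "0 < s * card ?L" using assms by (intro mult_pos_pos) linarith+
      then show ?thesis
        using \<open>card ?L * card ?R \<le> s * card ?R\<close> unfolding add_mult_distrib2 by linarith
    qed
    then have "card (edges H) < s * card (verts H)" using e unfolding split by linarith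
    then have "real (card (edges H)) < real s * real (card (verts H))"
      by (metis of_nat_less_iff of_nat_mult)
    then show "x < real s" using pos by (simp add: x pos_divide_less_eq)
  qed
  moreover have "?D \<noteq> {}"
  proof -
    have "subgraph ({0}, {}) ?G" using assms by (auto simp: subgraph_def simple_graph_def bipartite_host_def)
    then show ?thesis by fastforce
  qed
  ultimately show ?thesis
    unfolding max_density_def
    using Max_in[OF finite_subgraph_densities[OF simple_graph_bipartite_host]] by blast
qed

text \<open>Each vertex \<open>j\<close> of the large side has \<open>r(a - 1) + 1\<close> edges, so some colour \<open>k\<close> occurs on \<open>a\<close> of them,
leading to a set \<open>A\<close>. If the large side has \<open>b\<close> times as many vertices as there are pairs \<open>(A, k)\<close>,
then some pair is shared by \<open>b\<close> vertices.\<close>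

lemma is_ramsey_bipartite_host:
  assumes "1 \<le> a" "1 \<le> b" "1 \<le> r"
  obtains t where "is_ramsey (complete_bipartite a b) r (bipartite_host (r * (a - 1) + 1) t)"
proof -
  define s where "s = r * (a - 1) + 1"
  let ?I = "nsets {..<s} a \<times> {..<r}"
  define t where "t = b * card ?I"
  have finI: "finite ?I" by (simp add: finite_imp_finite_nsets)
  have "\<exists>k<r. \<exists>A B. mono_biclique (bipartite_host s t) a b c k A B"
    if c: "\<forall>e\<in>edges (bipartite_host s t). c e < r" for c
  proof -
    let ?R = "{s..<s + t}"
    have edge: "{i, j} \<in> edges (bipartite_host s t)" if "i < s" "j \<in> ?R" for i j
      using that by (auto simp: bipartite_host_def)
    have "\<exists>p. p \<in> ?I \<and> (\<forall>i\<in>fst p. c {i, j} = snd p)" if j: "j \<in> ?R" for j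
    proof -
      have "(\<lambda>i. c {i, j}) \<in> {..<s} \<rightarrow> {..<r}" using c edge j by blast
      then have "\<exists>k\<in>{..<r}. card {..<s} \<le> card ((\<lambda>i. c {i, j}) -` {k} \<inter> {..<s}) * card {..<r}"
        using assms(3) by (intro pigeonhole_card) (auto simp: lessThan_empty_iff)
      then obtain k where k: "k < r" "s \<le> card ((\<lambda>i. c {i, j}) -` {k} \<inter> {..<s}) * r"
        by auto
      have "\<not> card ((\<lambda>i. c {i, j}) -` {k} \<inter> {..<s}) \<le> a - 1"
      proof
        assume "card ((\<lambda>i. c {i, j}) -` {k} \<inter> {..<s}) \<le> a - 1"
        then have "card ((\<lambda>i. c {i, j}) -` {k} \<inter> {..<s}) * r \<le> (a - 1) * r"
          by (rule mult_le_mono1)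
        then have "s \<le> r * (a - 1)" using k(2) mult.commute[of r "a - 1"] by linarith
        then show False by (simp add: s_def)
      qed
      then have "a \<le> card ((\<lambda>i. c {i, j}) -` {k} \<inter> {..<s})" by simp
      then obtain A where A: "A \<subseteq> (\<lambda>i. c {i, j}) -` {k} \<inter> {..<s}" "card A = a"
        using obtain_subset_with_card_n by metis
      then have "(A, k) \<in> ?I" using k(1) finite_subset[of A "{..<s}"] by (auto simp: nsets_def)
      then show ?thesis using A(1) by (intro exI[of _ "(A, k)"]) auto
    qed
    then have "\<forall>j\<in>?R. \<exists>p. p \<in> ?I \<and> (\<forall>i\<in>fst p. c {i, j} = snd p)" by (rule ballI)
    from bchoice[OF this] obtain g
      where g: "\<forall>j\<in>?R. g j \<in> ?I \<and> (\<forall>i\<in>fst (g j). c {i, j} = snd (g j))"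
      by (elim exE)
    have "nsets {..<s} a \<noteq> {}"
    proof -
      have "1 * (a - 1) \<le> r * (a - 1)" using assms(3) by (rule mult_le_mono1)
      then have "a \<le> s" unfolding s_def by linarith
      then show ?thesis by (simp add: nsets_eq_empty_iff)
    qed
    then have I_pos: "card ?I > 0" using finI assms(3) by (simp add: card_gt_0_iff lessThan_empty_iff)
    have "\<exists>p\<in>?I. card ?R \<le> card (g -` {p} \<inter> ?R) * card ?I"
      using g finI I_pos by (intro pigeonhole_card) auto
    then obtain A k where Ak: "(A, k) \<in> ?I" "b * card ?I \<le> card (g -` {(A, k)} \<inter> ?R) * card ?I"
      by (auto simp: t_def)
    then have "b \<le> card (g -` {(A, k)} \<inter> ?R)" using I_pos by (simp del: card_cartesian_product)
    then obtain B where B: "B \<subseteq> g -` {(A, k)} \<inter> ?R" "card B = b"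
      using obtain_subset_with_card_n by metis
    have A: "A \<subseteq> {..<s}" "card A = a" "k < r" using Ak(1) by (auto simp: nsets_def)
    have "mono_biclique (bipartite_host s t) a b c k A B"
      unfolding mono_biclique_def
    proof (intro conjI ballI)
      show "A \<subseteq> verts (bipartite_host s t)" "B \<subseteq> verts (bipartite_host s t)"
        using A(1) B(1) by (auto simp: bipartite_host_def)
      show "A \<inter> B = {}" using A(1) B(1) by fastforce
      fix x y assume "x \<in> A" "y \<in> B"
      then have xy: "x < s" "y \<in> ?R" "g y = (A, k)" using A(1) B(1) by auto
      then show "{x, y} \<in> edges (bipartite_host s t)" by (intro edge)
      show "c {x, y} = k" using bspec[OF g xy(2)] xy(3) \<open>x \<in> A\<close> by simp
    qed (use A B in auto)
    then show ?thesis using A(3) by blast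
  qed
  then have "is_ramsey (complete_bipartite a b) r (bipartite_host s t)"
    unfolding is_ramsey_complete_bipartite_iff[OF assms(1,2)] by blast
  then show thesis using that by (simp add: s_def)
qed

theorem theorem1:
  fixes a b r :: nat and \<epsilon> :: real
  assumes "a \<ge> 2" and "b \<ge> (a - 1)^2 + 1" and "r \<ge> 2"
    and "\<epsilon> = (real r * (real a - 1) - 1) /
      max (real (ramsey_number (complete_bipartite a b) r)) (2 * real r * (real a - 1) + 1)"
  shows "\<epsilon> < 1 / 2 \<and>
    real r * (real a - 1) - \<epsilon> \<le> ramsey_density (complete_bipartite a b) r \<and>
    ramsey_density (complete_bipartite a b) r < real r * (real a - 1) + 1"
proof -
  let ?K = "complete_bipartite a b"
  define d where "d = r * (a - 1)"
  define N where "N = max (ramsey_number ?K r) (2 * d + 1)"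
  let ?S = "{max_density G | G :: nat ugraph. simple_graph G \<and> is_ramsey ?K r G}"
  have ab: "1 \<le> a" "1 \<le> b" "1 \<le> r" using assms(1-3) by auto
  have d: "real d = real r * (real a - 1)" using assms(1) by (simp add: d_def of_nat_diff)
  have "1 * 1 \<le> r * (a - 1)" using assms(1,3) by (intro mult_le_mono) auto
  then have d1: "1 \<le> d" by (simp add: d_def)
  have "real N = max (real (ramsey_number ?K r)) (2 * real r * (real a - 1) + 1)"
    by (simp add: N_def d of_nat_max algebra_simps)
  then have \<epsilon>: "\<epsilon> = (real d - 1) / real N" by (simp add: assms(4) d)
  have "2 * real d + 1 \<le> real N" by (simp add: N_def)
  then have "\<epsilon> < 1 / 2" using d1 by (simp add: \<epsilon> pos_divide_less_eq)
  have lower: "real d - \<epsilon> \<le> x" if "x \<in> ?S" for x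
    using that ramsey_graph_density_ge[OF _ _ assms(1,2) d_def d1 N_def] unfolding \<epsilon> by blast
  obtain t where "is_ramsey ?K r (bipartite_host (r * (a - 1) + 1) t)"
    using is_ramsey_bipartite_host[OF ab] .
  then have host: "max_density (bipartite_host (d + 1) t) \<in> ?S"
    using simple_graph_bipartite_host unfolding d_def by blast
  have "real d - \<epsilon> \<le> ramsey_density ?K r"
    unfolding ramsey_density_def using host lower by (intro cInf_greatest) auto
  moreover have "ramsey_density ?K r \<le> max_density (bipartite_host (d + 1) t)"
    unfolding ramsey_density_def using host
    by (rule cInf_lower) (rule bdd_belowI[of _ "real d - \<epsilon>"], rule lower)
  moreover have "max_density (bipartite_host (d + 1) t) < real (d + 1)"
    by (rule max_density_bipartite_host_less) simp
  ultimately show ?thesis using \<open>\<epsilon> < 1 / 2\<close> unfolding d[symmetric] by simp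
qed

end
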